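(* For every $d\ge 2$ and every $r\ge 3$, there is no algorithm that, for some $\epsilon>0$, solves every $n$-variable instance of Max-$(d,r)$-CSP in time $(d-\epsilon)^n\cdot n^{\mathcal{O}(1)}$, unless the M3SH fails.
   Context: An instance of $(d,r)$-CSP is a pair $(\mathcal{V},\mathcal{C})$ of a set of variables with domain $[d]=\{1,\dots,d\}$ and a set of constraints, each involving a sequence of at most $r$ variables and specifying a relation on them (a set of allowed tuples in $[d]^{\text{arity}}$). Max-$(d,r)$-CSP: given such an instance, find the minimum number of constraints whose deletion yields a satisfiable instance (equivalently, an assignment $\mathcal{V}\to[d]$ violating the fewest constraints). Max 3-Sat: given a CNF formula with at most three literals per clause, find an assignment violating the minimum number of clauses. M3SH: there is no $\epsilon>0$ such that every $n$-variable Max 3-Sat instance can be solved in time $(2-\epsilon)^n\cdot n^{\mathcal{O}(1)}$. *)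

theory Defs
  imports Complex_Main "HOL-Library.Landau_Symbols" "HOL-Library.FuncSet"
begin

section \<open>Algorithms and running time\<close>

text \<open>
  The model of computation is the WHILE language over binary trees (N. D. Jones,
  \<^emph>\<open>Computability and Complexity from a Programming Perspective\<close>, 1997): finitely many
  tree-valued variables; every constructor, selector, assignment and emptiness test costs one unit.
  There is no equality test on trees, so a step is a constant number of operations on pointers into
  a shared heap. With memory held in a balanced tree, the language simulates \<open>T\<close> steps of a
  random access machine with logarithmic cost in time \<open>T (log T)\<^sup>O\<^sup>(\<^sup>1\<^sup>)\<close>, and conversely. A bound of the
  form \<open>b\<^sup>n n\<^sup>O\<^sup>(\<^sup>1\<^sup>)\<close> thus means the same in both models. (It would not survive a simulation by Turing
  machines with quadratic overhead.)
\<close>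

datatype tree = Leaf | Node tree tree

fun left :: "tree \<Rightarrow> tree" where
  "left Leaf = Leaf"
| "left (Node a b) = a"

fun right :: "tree \<Rightarrow> tree" where
  "right Leaf = Leaf"
| "right (Node a b) = b"

datatype expr = EVar nat | ELeaf | ENode expr expr | ELeft expr | ERight expr

type_synonym store = "nat \<Rightarrow> tree"

fun eval :: "expr \<Rightarrow> store \<Rightarrow> tree" where
  "eval (EVar v) s = s v"
| "eval ELeaf s = Leaf"
| "eval (ENode e f) s = Node (eval e s) (eval f s)"
| "eval (ELeft e) s = left (eval e s)"
| "eval (ERight e) s = right (eval e s)"

fun cost :: "expr \<Rightarrow> nat" where
  "cost (EVar v) = 1"
| "cost ELeaf = 1"
| "cost (ENode e f) = 1 + cost e + cost f"
| "cost (ELeft e) = 1 + cost e"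
| "cost (ERight e) = 1 + cost e"

datatype prog = Assign nat expr | Seq prog prog | Cond expr prog prog | While expr prog

inductive exec :: "prog \<Rightarrow> store \<Rightarrow> nat \<Rightarrow> store \<Rightarrow> bool" where
  Assign: "exec (Assign v e) s (1 + cost e) (s(v := eval e s))"
| Seq: "exec p s t s' \<Longrightarrow> exec q s' t' s'' \<Longrightarrow> exec (Seq p q) s (t + t') s''"
| CondTrue: "eval e s \<noteq> Leaf \<Longrightarrow> exec p s t s' \<Longrightarrow> exec (Cond e p q) s (1 + cost e + t) s'"
| CondFalse: "eval e s = Leaf \<Longrightarrow> exec q s t s' \<Longrightarrow> exec (Cond e p q) s (1 + cost e + t) s'"
| WhileFalse: "eval e s = Leaf \<Longrightarrow> exec (While e p) s (1 + cost e) s"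
| WhileTrue: "eval e s \<noteq> Leaf \<Longrightarrow> exec p s t s' \<Longrightarrow> exec (While e p) s' t' s''
    \<Longrightarrow> exec (While e p) s (1 + cost e + t + t') s''"

text \<open>Variable 0 holds the input at the start and the output at the end.\<close>

definition runs :: "prog \<Rightarrow> tree \<Rightarrow> nat \<Rightarrow> tree \<Rightarrow> bool" where
  "runs p x t y \<longleftrightarrow> (\<exists>s. exec p ((\<lambda>_. Leaf)(0 := x)) t s \<and> s 0 = y)"

lemma exec_deterministic:
  "exec p s t s' \<Longrightarrow> exec p s u s'' \<Longrightarrow> t = u \<and> s' = s''"
proof (induction arbitrary: u s'' rule: exec.induct)
  case (Assign v e s)
  from Assign.prems show ?case by (cases rule: exec.cases) simp_all
next
  case (Seq p s t s' q t' s'')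
  from Seq.prems show ?case by (cases rule: exec.cases) (simp_all, metis Seq.IH)
next
  case (CondTrue e s p t s' q)
  from CondTrue.prems CondTrue.hyps show ?case
    by (cases rule: exec.cases) (simp_all, metis CondTrue.IH)
next
  case (CondFalse e s q t s' p)
  from CondFalse.prems CondFalse.hyps show ?case
    by (cases rule: exec.cases) (simp_all, metis CondFalse.IH)
next
  case (WhileFalse e s p)
  from WhileFalse.prems WhileFalse.hyps show ?case by (cases rule: exec.cases) simp_all
next
  case (WhileTrue e s p t s' t' s'')
  from WhileTrue.prems WhileTrue.hyps show ?case
    by (cases rule: exec.cases) (simp_all, metis WhileTrue.IH)
qed

lemma runs_deterministic: "runs p x t y \<Longrightarrow> runs p x u z \<Longrightarrow> t = u \<and> y = z"
  unfolding runs_def using exec_deterministic by blast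

text \<open>The growth class \<open>n\<^sup>O\<^sup>(\<^sup>1\<^sup>)\<close>.\<close>

definition poly_growth :: "(nat \<Rightarrow> real) \<Rightarrow> bool" where
  "poly_growth g \<longleftrightarrow> (\<exists>c::nat. g \<in> O(\<lambda>n. real n ^ c))"


section \<open>Encoding of data as trees\<close>

fun enc_list :: "('a \<Rightarrow> tree) \<Rightarrow> 'a list \<Rightarrow> tree" where
  "enc_list f [] = Leaf"
| "enc_list f (x # xs) = Node (f x) (enc_list f xs)"

fun enc_pair :: "('a \<Rightarrow> tree) \<Rightarrow> ('b \<Rightarrow> tree) \<Rightarrow> 'a \<times> 'b \<Rightarrow> tree" where
  "enc_pair f g (x, y) = Node (f x) (g y)"

fun enc_bool :: "bool \<Rightarrow> tree" where
  "enc_bool False = Leaf"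
| "enc_bool True = Node Leaf Leaf"

text \<open>
  Unary notation is harmless here: all numbers that are encoded are variables, domain values, and
  numbers of variables or constraints, which are polynomially bounded in the number of variables.
\<close>

fun enc_nat :: "nat \<Rightarrow> tree" where
  "enc_nat 0 = Leaf"
| "enc_nat (Suc n) = Node Leaf (enc_nat n)"


section \<open>Max-CSP\<close>

text \<open>
  The variables of an \<open>n\<close>-variable instance are \<open>0, \<dots>, n - 1\<close>. A constraint consists of its scope (a
  sequence of variables, in which repetitions are possible) and the set of allowed tuples.
\<close>

type_synonym constr = "nat list \<times> nat list set"

definition csp_instance :: "nat \<Rightarrow> nat \<Rightarrow> nat \<Rightarrow> constr set \<Rightarrow> bool" where
  "csp_instance d r n C \<longleftrightarrow>
    (\<forall>(xs, R) \<in> C. length xs \<le> r \<and> set xs \<subseteq> {..<n} \<and>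
       R \<subseteq> {as. length as = length xs \<and> set as \<subseteq> {1..d}})"

definition csp_satisfiable :: "nat \<Rightarrow> nat \<Rightarrow> constr set \<Rightarrow> bool" where
  "csp_satisfiable d n C \<longleftrightarrow>
    (\<exists>\<alpha> \<in> {..<n} \<rightarrow> {1..d}. \<forall>(xs, R) \<in> C. map \<alpha> xs \<in> R)"

definition max_csp :: "nat \<Rightarrow> nat \<Rightarrow> constr set \<Rightarrow> nat" where
  "max_csp d n C = (LEAST k. \<exists>D \<subseteq> C. card D = k \<and> csp_satisfiable d n (C - D))"

text \<open>
  An input tree lists the constraints of the set \<open>C\<close>, and the tuples of each relation, in some order
  and without repetition. An algorithm has to cope with every such listing.
\<close>

definition csp_input :: "nat \<Rightarrow> constr set \<Rightarrow> tree \<Rightarrow> bool" where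
  "csp_input n C x \<longleftrightarrow>
    (\<exists>cs :: (nat list \<times> nat list list) list.
       distinct (map (\<lambda>(xs, L). (xs, set L)) cs) \<and>
       (\<forall>(xs, L) \<in> set cs. distinct L) \<and>
       C = (\<lambda>(xs, L). (xs, set L)) ` set cs \<and>
       x = Node (enc_nat n)
             (enc_list (enc_pair (enc_list enc_nat) (enc_list (enc_list enc_nat))) cs))"

definition solves_max_csp :: "prog \<Rightarrow> nat \<Rightarrow> nat \<Rightarrow> (nat \<Rightarrow> real) \<Rightarrow> bool" where
  "solves_max_csp p d r T \<longleftrightarrow>
    (\<forall>n C x. csp_instance d r n C \<longrightarrow> csp_input n C x \<longrightarrow>
       (\<exists>t. runs p x t (enc_nat (max_csp d n C)) \<and> real t \<le> T n))"


section \<open>Max 3-Sat\<close>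

text \<open>The literal \<open>(v, True)\<close> is the variable \<open>v\<close>, and \<open>(v, False)\<close> is its negation.\<close>

type_synonym literal = "nat \<times> bool"

definition cnf3 :: "nat \<Rightarrow> literal set set \<Rightarrow> bool" where
  "cnf3 n \<phi> \<longleftrightarrow> (\<forall>c \<in> \<phi>. c \<subseteq> {..<n} \<times> UNIV \<and> card c \<le> 3)"

definition violated :: "literal set set \<Rightarrow> (nat \<Rightarrow> bool) \<Rightarrow> literal set set" where
  "violated \<phi> \<beta> = {c \<in> \<phi>. \<not> (\<exists>(v, b) \<in> c. \<beta> v = b)}"

definition optimal_assignment :: "literal set set \<Rightarrow> (nat \<Rightarrow> bool) \<Rightarrow> bool" where
  "optimal_assignment \<phi> \<beta> \<longleftrightarrow> (\<forall>\<gamma>. card (violated \<phi> \<beta>) \<le> card (violated \<phi> \<gamma>))"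

definition cnf_input :: "nat \<Rightarrow> literal set set \<Rightarrow> tree \<Rightarrow> bool" where
  "cnf_input n \<phi> x \<longleftrightarrow>
    (\<exists>cs :: literal list list.
       distinct (map set cs) \<and> (\<forall>c \<in> set cs. distinct c) \<and> \<phi> = set ` set cs \<and>
       x = Node (enc_nat n) (enc_list (enc_list (enc_pair enc_nat enc_bool)) cs))"

definition solves_max_3sat :: "prog \<Rightarrow> (nat \<Rightarrow> real) \<Rightarrow> bool" where
  "solves_max_3sat p T \<longleftrightarrow>
    (\<forall>n \<phi> x. cnf3 n \<phi> \<longrightarrow> cnf_input n \<phi> x \<longrightarrow>
       (\<exists>t \<beta>. runs p x t (enc_list enc_bool (map \<beta> [0..<n])) \<and>
              optimal_assignment \<phi> \<beta> \<and> real t \<le> T n))"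

text \<open>
  The upper bound on \<open>\<epsilon>\<close> loses nothing, since no running time is bounded by a power of a base
  \<open>2 - \<epsilon> \<le> 0\<close>; it keeps signs from cancelling in the product below.
\<close>

definition M3SH :: bool where
  "M3SH \<longleftrightarrow>
    \<not> (\<exists>\<epsilon>::real. 0 < \<epsilon> \<and> \<epsilon> < 2 \<and>
         (\<exists>p g. poly_growth g \<and> solves_max_3sat p (\<lambda>n. (2 - \<epsilon>) ^ n * g n)))"

end

theory Submission
  imports Defs
begin

text \<open>
  Let \<open>2 ^ (b - 1) < d \<le> 2 ^ b\<close>. Split the Boolean variables into groups of \<open>b\<close>; the values of a group
  are the residues modulo \<open>2 ^ b\<close>, and a \<^emph>\<open>row\<close> is a set of \<open>d\<close> consecutive ones. Once a row is guessed
  for every group, the formula becomes a Max-CSP with one variable per group, whose value selects an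
  element of the row. A clause with at most three literals touches at most three groups, so it becomes
  a constraint of arity at most three.

  A row contains each value with density \<open>d / 2 ^ b\<close>, so by averaging all value vectors of \<open>q\<close> groups
  are covered by a number \<open>K\<close> of row vectors that exceeds \<open>(2 ^ b / d) ^ q\<close> only by a factor linear in
  \<open>q\<close>. For large \<open>q\<close> this gives \<open>K * (d - \<epsilon>) ^ q < 2 ^ (b * q)\<close>, and trying all combinations of covering
  row vectors beats \<open>2 ^ n\<close>.

  Constraints form a set, so different clauses must yield different constraints. They do, because a
  row contains more than half of the values of a group: distinct literals are distinct and
  nonconstant functions on it.

  An optimal assignment is found from optimal values by self-reduction. A literal is fixed softly,
  by one additional constraint: the optimum stays the same iff some optimal assignment satisfies it.
\<close>

section \<open>Verification of WHILE programs\<close>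

text \<open>When \<open>d\<close> is not a power of two, treating the groups one by one is not good
  enough: fewer bits per CSP variable leave domain values idle, while with \<open>b\<close> bits
  each group needs two rows, and two branches with \<open>d\<close> values each exceed
  \<open>2 ^ b\<close>. For small \<open>\<epsilon>\<close> both losses outweigh the gain. Covering
  \<open>q\<close> groups jointly amortises the rounding: the number of branches per group tends to
  \<open>2 ^ b / d\<close>, and the geometric factor \<open>((d - \<epsilon>) / d) ^ q\<close>
  absorbs what is linear in \<open>q\<close>.

  Both \<open>q\<close> and the cover depend on \<open>d\<close> and \<open>\<epsilon>\<close>
  alone. Hence an existence proof suffices: the cover is compiled into the program as constants, and
  only the number of blocks of \<open>q\<close> groups grows with the formula. Row vectors may
  overlap, because every CSP assignment in every branch decodes to a Boolean assignment, so no
  branch reports a value below the optimum.\<close>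

fun writes :: "prog \<Rightarrow> nat set" where
  "writes (Assign v e) = {v}"
| "writes (Seq p q) = writes p \<union> writes q"
| "writes (Cond e p q) = writes p \<union> writes q"
| "writes (While e p) = writes p"

lemma exec_unchanged: "exec p s t s' \<Longrightarrow> v \<notin> writes p \<Longrightarrow> s' v = s v"
  by (induction rule: exec.induct) auto

text \<open>Execution is deterministic, so the existence of one good run is total correctness.
  \<open>T\<close> is only an upper bound, which lets both branches of a conditional share
  it.\<close>

definition reaches :: "prog \<Rightarrow> store \<Rightarrow> nat \<Rightarrow> (store \<Rightarrow> bool) \<Rightarrow> bool" where
  "reaches p s T Q \<longleftrightarrow> (\<exists>t s'. exec p s t s' \<and> t \<le> T \<and> Q s')"

text \<open>Also the frame rule: the new postcondition may use that variables outside
  \<open>writes p\<close> are unchanged, so a specification mentions only what its program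
  changes.\<close>

lemma reaches_mono:
  assumes "reaches p s T Q" "T \<le> T'"
    "\<And>s'. Q s' \<Longrightarrow> (\<And>v. v \<notin> writes p \<Longrightarrow> s' v = s v) \<Longrightarrow> Q' s'"
  shows "reaches p s T' Q'"
proof -
  from assms(1) obtain t s' where *: "exec p s t s'" "t \<le> T" "Q s'" by (auto simp: reaches_def)
  with assms(2) assms(3)[OF *(3) exec_unchanged[OF *(1)]] show ?thesis
    unfolding reaches_def by (intro exI[of _ t] exI[of _ s']) auto
qed

lemma reaches_Assign:
  "Q (s(v := eval e s)) \<Longrightarrow> 1 + cost e \<le> T \<Longrightarrow> reaches (Assign v e) s T Q"
  unfolding reaches_def using exec.Assign by blast

lemma reaches_Seq:
  assumes "reaches p s T (\<lambda>s'. reaches q s' T' Q)" "T + T' \<le> T''"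
  shows "reaches (Seq p q) s T'' Q"
proof -
  from assms(1) obtain t s' t' s'' where *: "exec p s t s'" "t \<le> T" "exec q s' t' s''" "t' \<le> T'" "Q s''"
    by (auto simp: reaches_def)
  with exec.Seq[OF *(1,3)] assms(2) show ?thesis
    unfolding reaches_def by (intro exI[of _ "t + t'"] exI[of _ s'']) auto
qed

lemma reaches_Assign_Seq:
  "reaches q (s(v := eval e s)) T Q \<Longrightarrow> 1 + cost e + T \<le> T' \<Longrightarrow>
    reaches (Seq (Assign v e) q) s T' Q"
  by (rule reaches_Seq[OF reaches_Assign]) auto

lemma reaches_Cond:
  assumes "eval e s \<noteq> Leaf \<Longrightarrow> reaches p s T Q" "eval e s = Leaf \<Longrightarrow> reaches q s T Q"
    "1 + cost e + T \<le> T'"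
  shows "reaches (Cond e p q) s T' Q"
proof (cases "eval e s = Leaf")
  case True
  with assms(2) obtain t s' where "exec q s t s'" "t \<le> T" "Q s'" by (auto simp: reaches_def)
  with CondFalse[OF True this(1)] assms(3) show ?thesis unfolding reaches_def
    by (intro exI[of _ "1 + cost e + t"] exI[of _ s']) auto
next
  case False
  with assms(1) obtain t s' where "exec p s t s'" "t \<le> T" "Q s'" by (auto simp: reaches_def)
  with CondTrue[OF False this(1)] assms(3) show ?thesis unfolding reaches_def
    by (intro exI[of _ "1 + cost e + t"] exI[of _ s']) auto
qed

text \<open>The invariant is indexed by the number of remaining rounds, which gives termination and
  the time bound together. Frame facts refer to the store before the loop, so invariants can omit
  whatever the body never writes.\<close>

lemma reaches_While_count:
  assumes init: "I k s"
    and step: "\<And>k s'. I (Suc k) s' \<Longrightarrow> (\<And>v. v \<notin> writes p \<Longrightarrow> s' v = s v) \<Longrightarrow>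
        eval e s' \<noteq> Leaf \<and> reaches p s' T (I k)"
    and stop: "\<And>s'. I 0 s' \<Longrightarrow> (\<And>v. v \<notin> writes p \<Longrightarrow> s' v = s v) \<Longrightarrow> eval e s' = Leaf \<and> Q s'"
    and time: "k * (1 + cost e + T) + 1 + cost e \<le> T'"
  shows "reaches (While e p) s T' Q"
proof -
  have "\<exists>t s''. exec (While e p) s' t s'' \<and> t \<le> k * (1 + cost e + T) + 1 + cost e \<and> Q s''"
    if "I k s'" "\<And>v. v \<notin> writes p \<Longrightarrow> s' v = s v" for k s'
    using that
  proof (induction k arbitrary: s')
    case 0
    with stop[OF 0] WhileFalse[of e s' p] show ?case by auto
  next
    case (Suc k)
    from step[OF Suc.prems] obtain t s1
      where *: "eval e s' \<noteq> Leaf" "exec p s' t s1" "t \<le> T" "I k s1"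
      by (auto simp: reaches_def)
    have "s1 v = s v" if "v \<notin> writes p" for v
      using exec_unchanged[OF *(2) that] Suc.prems(2)[OF that] by simp
    from Suc.IH[OF *(4) this] obtain t' s2
      where "exec (While e p) s1 t' s2" "t' \<le> k * (1 + cost e + T) + 1 + cost e" "Q s2"
      by blast
    with WhileTrue[OF *(1,2) this(1)] *(3) show ?case
      by (intro exI[of _ "1 + cost e + t + t'"] exI[of _ s2]) auto
  qed
  from this[OF init] obtain t s'' where
    "exec (While e p) s t s''" "t \<le> k * (1 + cost e + T) + 1 + cost e" "Q s''" by auto
  with time show ?thesis unfolding reaches_def by (intro exI[of _ t] exI[of _ s'']) auto
qed

lemma reaches_While_list:
  assumes init: "I xs s"
    and step: "\<And>x xs s'. I (x # xs) s' \<Longrightarrow> (\<And>v. v \<notin> writes p \<Longrightarrow> s' v = s v) \<Longrightarrow>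
        eval e s' \<noteq> Leaf \<and> reaches p s' T (I xs)"
    and stop: "\<And>s'. I [] s' \<Longrightarrow> (\<And>v. v \<notin> writes p \<Longrightarrow> s' v = s v) \<Longrightarrow> eval e s' = Leaf \<and> Q s'"
    and time: "length xs * (1 + cost e + T) + 1 + cost e \<le> T'"
  shows "reaches (While e p) s T' Q"
proof (rule reaches_While_count[where I = "\<lambda>k s. \<exists>xs. length xs = k \<and> I xs s", OF _ _ _ time])
  fix k s' assume "\<exists>xs. length xs = Suc k \<and> I xs s'" and fr: "\<And>v. v \<notin> writes p \<Longrightarrow> s' v = s v"
  then obtain x xs where "length xs = k" "I (x # xs) s'" by (auto simp: length_Suc_conv)
  with step[OF this(2) fr] show "eval e s' \<noteq> Leaf \<and> reaches p s' T (\<lambda>s. \<exists>xs. length xs = k \<and> I xs s)"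
    by (auto elim: reaches_mono)
qed (use init stop in auto)

section \<open>Case distinctions on finitely many trees\<close>

fun const_expr :: "tree \<Rightarrow> expr" where
  "const_expr Leaf = ELeaf"
| "const_expr (Node a b) = ENode (const_expr a) (const_expr b)"

lemma eval_const_expr [simp]: "eval (const_expr t) s = t"
  by (induction t) auto

text \<open>The language tests only for emptiness, so a comparison with a fixed tree is unfolded
  into nested tests along its shape.\<close>

fun eq_test :: "tree \<Rightarrow> expr \<Rightarrow> prog \<Rightarrow> prog \<Rightarrow> prog" where
  "eq_test Leaf e p q = Cond e q p"
| "eq_test (Node a b) e p q = Cond e (eq_test a (ELeft e) (eq_test b (ERight e) p q) q) q"

lemma writes_eq_test: "writes (eq_test c e p q) = writes p \<union> writes q"
  by (induction c arbitrary: e p q) auto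

fun eq_test_cost :: "tree \<Rightarrow> nat \<Rightarrow> nat" where
  "eq_test_cost Leaf k = 1 + k"
| "eq_test_cost (Node a b) k = 1 + k + eq_test_cost a (1 + k) + eq_test_cost b (1 + k)"

lemma reaches_eq_test:
  assumes "eval e s = c \<Longrightarrow> reaches p s T Q" "eval e s \<noteq> c \<Longrightarrow> reaches q s T Q"
  shows "reaches (eq_test c e p q) s (eq_test_cost c (cost e) + T) Q"
  using assms
proof (induction c arbitrary: e p T)
  case Leaf
  then show ?case by (auto intro!: reaches_Cond[where T = T])
next
  case (Node a b)
  have *: "eq_test_cost a (1 + cost e) + (eq_test_cost b (1 + cost e) + T) + 1 + cost e
      = eq_test_cost (Node a b) (cost e) + T" by simp
  show ?case unfolding eq_test.simps
  proof (rule reaches_Cond[where T = "eq_test_cost a (1 + cost e) + (eq_test_cost b (1 + cost e) + T)"])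
    assume "eval e s \<noteq> Leaf"
    then obtain x y where xy: "eval e s = Node x y" by (cases "eval e s") auto
    have 1: "reaches (eq_test b (ERight e) p q) s (eq_test_cost b (cost (ERight e)) + T) Q"
      if "x = a" by (rule Node.IH(2)) (use Node.prems xy that in auto)
    have "reaches (eq_test a (ELeft e) (eq_test b (ERight e) p q) q) s
       (eq_test_cost a (cost (ELeft e)) + (eq_test_cost b (1 + cost e) + T)) Q"
      by (rule Node.IH(1)) (use 1 Node.prems xy in \<open>auto elim: reaches_mono\<close>)
    then show "reaches (eq_test a (ELeft e) (eq_test b (ERight e) p q) q) s
       (eq_test_cost a (1 + cost e) + (eq_test_cost b (1 + cost e) + T)) Q" by simp
  next
    assume "eval e s = Leaf"
    with Node.prems show "reaches q s (eq_test_cost a (1 + cost e) + (eq_test_cost b (1 + cost e) + T)) Q"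
      by (auto elim: reaches_mono)
  qed simp
qed

text \<open>A cascade of comparisons with the elements of \<open>X\<close>, whose time is
  independent of the argument. It replaces programming any function on data of bounded size.\<close>

lemma finite_function_prog:
  assumes "finite X"
  shows "\<exists>p T. writes p = {v} \<and>
    (\<forall>s. eval e s \<in> X \<longrightarrow> reaches p s T (\<lambda>s'. s' v = f (eval e s)))"
  using assms
proof induction
  case empty
  show ?case by (rule exI[of _ "Assign v ELeaf"]) simp
next
  case (insert c X)
  then obtain p T where p: "writes p = {v}"
    "\<And>s. eval e s \<in> X \<Longrightarrow> reaches p s T (\<lambda>s'. s' v = f (eval e s))" by blast
  let ?a = "Assign v (const_expr (f c))"
  let ?p = "eq_test c e ?a p" and ?T = "1 + cost (const_expr (f c)) + T"
  have "reaches ?p s (eq_test_cost c (cost e) + ?T) (\<lambda>s'. s' v = f (eval e s))"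
    if "eval e s \<in> insert c X" for s
  proof (rule reaches_eq_test)
    assume "eval e s = c"
    then show "reaches ?a s ?T (\<lambda>s'. s' v = f (eval e s))" by (auto intro: reaches_Assign)
  next
    assume "eval e s \<noteq> c"
    with that have "reaches p s T (\<lambda>s'. s' v = f (eval e s))" by (intro p(2)) simp
    then show "reaches p s ?T (\<lambda>s'. s' v = f (eval e s))" by (rule reaches_mono) auto
  qed
  moreover have "writes ?p = {v}" by (simp add: writes_eq_test p)
  ultimately show ?case by blast
qed

section \<open>Running a program as a subroutine\<close>

fun expr_vars :: "expr \<Rightarrow> nat set" where
  "expr_vars (EVar v) = {v}"
| "expr_vars ELeaf = {}"
| "expr_vars (ENode e f) = expr_vars e \<union> expr_vars f"
| "expr_vars (ELeft e) = expr_vars e"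
| "expr_vars (ERight e) = expr_vars e"

fun prog_vars :: "prog \<Rightarrow> nat set" where
  "prog_vars (Assign v e) = insert v (expr_vars e)"
| "prog_vars (Seq p q) = prog_vars p \<union> prog_vars q"
| "prog_vars (Cond e p q) = expr_vars e \<union> prog_vars p \<union> prog_vars q"
| "prog_vars (While e p) = expr_vars e \<union> prog_vars p"

lemma finite_expr_vars [simp]: "finite (expr_vars e)"
  by (induction e) auto

lemma finite_prog_vars [simp]: "finite (prog_vars p)"
  by (induction p) auto

lemma writes_subset_prog_vars: "writes p \<subseteq> prog_vars p"
  by (induction p) auto

lemma eval_cong: "(\<And>v. v \<in> expr_vars e \<Longrightarrow> s v = s' v) \<Longrightarrow> eval e s = eval e s'"
  by (induction e) auto

text \<open>\<open>runs\<close> speaks of a store that is empty apart from the input, whereas a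
  subroutine runs in the store of its caller. \<open>A\<close> may exceed the variables of
  \<open>p\<close>, so that the induction passes to subprograms with \<open>A\<close> fixed.\<close>

lemma exec_cong:
  assumes "exec p s t s'" "prog_vars p \<subseteq> A" "\<And>v. v \<in> A \<Longrightarrow> s v = u v"
  shows "\<exists>u'. exec p u t u' \<and> (\<forall>v \<in> A. u' v = s' v)"
  using assms
proof (induction arbitrary: u rule: exec.induct)
  case (Assign v e s)
  then have "eval e s = eval e u" by (intro eval_cong) auto
  with Assign.prems show ?case
    by (intro exI[of _ "u(v := eval e u)"] conjI exec.Assign) auto
next
  case (Seq p s t s' q t' s'')
  from Seq.IH(1)[of u] Seq.prems obtain u' where u': "exec p u t u'" "\<forall>v \<in> A. u' v = s' v" by auto
  with Seq.IH(2)[of u'] Seq.prems obtain u'' where "exec q u' t' u''" "\<forall>v \<in> A. u'' v = s'' v" by auto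
  with u' show ?case by (blast intro: exec.Seq)
next
  case (CondTrue e s p t s' q)
  then have "eval e s = eval e u" by (intro eval_cong) auto
  moreover from CondTrue.IH[of u] CondTrue.prems obtain u' where "exec p u t u'" "\<forall>v \<in> A. u' v = s' v"
    by auto
  ultimately show ?case using CondTrue.hyps(1) by (intro exI[of _ u'] conjI exec.CondTrue) auto
next
  case (CondFalse e s q t s' p)
  then have "eval e s = eval e u" by (intro eval_cong) auto
  moreover from CondFalse.IH[of u] CondFalse.prems obtain u' where "exec q u t u'" "\<forall>v \<in> A. u' v = s' v"
    by auto
  ultimately show ?case using CondFalse.hyps(1) by (intro exI[of _ u'] conjI exec.CondFalse) auto
next
  case (WhileFalse e s p)
  then have "eval e s = eval e u" by (intro eval_cong) auto
  with WhileFalse show ?case by (intro exI[of _ u] conjI exec.WhileFalse) auto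
next
  case (WhileTrue e s p t s' t' s'')
  then have e: "eval e s = eval e u" by (intro eval_cong) auto
  from WhileTrue.IH(1)[of u] WhileTrue.prems obtain u' where u': "exec p u t u'" "\<forall>v \<in> A. u' v = s' v"
    by auto
  with WhileTrue.IH(2)[of u'] WhileTrue.prems obtain u''
    where "exec (While e p) u' t' u''" "\<forall>v \<in> A. u'' v = s'' v" by auto
  with exec.WhileTrue[OF _ u'(1) this(1)] e WhileTrue.hyps(1) show ?case by auto
qed

fun clear_prog :: "nat \<Rightarrow> prog" where
  "clear_prog 0 = Assign 0 ELeaf"
| "clear_prog (Suc k) = Seq (clear_prog k) (Assign (Suc k) ELeaf)"

lemma writes_clear_prog: "writes (clear_prog k) = {..k}"
  by (induction k) auto

lemma reaches_clear_prog: "reaches (clear_prog k) s (2 * k + 2) (\<lambda>s'. \<forall>v \<le> k. s' v = Leaf)"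
proof (induction k)
  case 0
  show ?case unfolding clear_prog.simps by (rule reaches_Assign) auto
next
  case (Suc k)
  show ?case unfolding clear_prog.simps
  proof (rule reaches_Seq[where T = "2 * k + 2" and T' = 2])
    show "reaches (clear_prog k) s (2 * k + 2)
        (\<lambda>s'. reaches (Assign (Suc k) ELeaf) s' 2 (\<lambda>s'. \<forall>v \<le> Suc k. s' v = Leaf))"
    proof (rule reaches_mono[OF Suc order_refl], rule reaches_Assign)
      fix s' :: store assume "\<forall>v \<le> k. s' v = Leaf"
      then show "\<forall>v \<le> Suc k. (s'(Suc k := eval ELeaf s')) v = Leaf" by (simp add: le_Suc_eq)
    qed simp
  qed simp
qed

text \<open>The variables are cleared on every call because earlier calls leave data behind. The
  argument is evaluated afterwards and must therefore avoid them.\<close>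

definition call_prog :: "prog \<Rightarrow> nat \<Rightarrow> expr \<Rightarrow> prog" where
  "call_prog p V e = Seq (clear_prog V) (Seq (Assign 0 e) p)"

lemma writes_call_prog:
  "prog_vars p \<subseteq> {..V} \<Longrightarrow> writes (call_prog p V e) = {..V}"
  using writes_subset_prog_vars[of p] by (auto simp: call_prog_def writes_clear_prog)

lemma reaches_call_prog:
  assumes vars: "prog_vars p \<subseteq> {..V}" "expr_vars e \<inter> {..V} = {}"
    and run: "runs p (eval e s) t y" and T: "2 * V + 3 + cost e + t \<le> T"
  shows "reaches (call_prog p V e) s T (\<lambda>s'. s' 0 = y)"
  unfolding call_prog_def
proof (rule reaches_Seq[where T = "2 * V + 2" and T' = "1 + cost e + t"])
  show "reaches (clear_prog V) s (2 * V + 2)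
      (\<lambda>s'. reaches (Seq (Assign 0 e) p) s' (1 + cost e + t) (\<lambda>s'. s' 0 = y))"
  proof (rule reaches_mono[OF reaches_clear_prog order_refl])
    fix s' assume s': "\<forall>v \<le> V. s' v = Leaf" "\<And>v. v \<notin> writes (clear_prog V) \<Longrightarrow> s' v = s v"
    have e: "eval e s' = eval e s"
    proof (rule eval_cong)
      fix v assume "v \<in> expr_vars e"
      then have "v \<notin> writes (clear_prog V)" using vars(2) by (auto simp: writes_clear_prog)
      then show "s' v = s v" by (rule s'(2))
    qed
    from run obtain s1 where s1: "exec p ((\<lambda>_. Leaf)(0 := eval e s)) t s1" "s1 0 = y"
      unfolding runs_def by blast
    have "((\<lambda>_. Leaf)(0 := eval e s)) v = (s'(0 := eval e s')) v" if "v \<in> {..V}" for v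
      using that s'(1) e by simp
    from exec_cong[OF s1(1) vars(1) this] s1(2)
    obtain u where "exec p (s'(0 := eval e s')) t u" "u 0 = y" by blast
    then have "reaches p (s'(0 := eval e s')) t (\<lambda>s'. s' 0 = y)" unfolding reaches_def by blast
    then show "reaches (Seq (Assign 0 e) p) s' (1 + cost e + t) (\<lambda>s'. s' 0 = y)"
      by (rule reaches_Assign_Seq) simp
  qed
qed (use T in simp)

section \<open>Lists and unary numbers as right spines\<close>

fun spine :: "tree \<Rightarrow> nat" where
  "spine Leaf = 0"
| "spine (Node a b) = Suc (spine b)"

lemma spine_enc_nat [simp]: "spine (enc_nat n) = n"
  by (induction n) auto

lemma spine_enc_list [simp]: "spine (enc_list f xs) = length xs"
  by (induction xs) auto

lemma spine_right: "spine (right x) = spine x - 1"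
  by (cases x) auto

lemma spine_funpow_right: "spine ((right ^^ k) x) = spine x - k"
  by (induction k) (auto simp: spine_right)

lemma spine_eq_0_iff: "spine x = 0 \<longleftrightarrow> x = Leaf"
  by (cases x) auto

lemma funpow_right_Leaf [simp]: "(right ^^ k) Leaf = Leaf"
  by (induction k) auto

lemma funpow_right_enc_list: "(right ^^ k) (enc_list f xs) = enc_list f (drop k xs)"
proof (induction xs arbitrary: k)
  case (Cons x xs)
  then show ?case by (cases k) (auto simp: funpow_swap1)
qed simp

lemma funpow_right_enc_nat: "(right ^^ k) (enc_nat n) = enc_nat (n - k)"
proof (induction n arbitrary: k)
  case (Suc n)
  then show ?case by (cases k) (auto simp: funpow_swap1)
qed simp

text \<open>Serves both as array access and as comparison: what remains of \<open>a\<close> is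
  \<open>Leaf\<close> iff its spine is no longer than that of \<open>b\<close>.\<close>

definition drop_prog :: "nat \<Rightarrow> nat \<Rightarrow> prog" where
  "drop_prog a b = While (EVar b) (Seq (Assign a (ERight (EVar a))) (Assign b (ERight (EVar b))))"

lemma writes_drop_prog: "writes (drop_prog a b) = {a, b}"
  by (auto simp: drop_prog_def)

lemma reaches_drop_prog:
  assumes "a \<noteq> b"
  shows "reaches (drop_prog a b) s (8 * spine (s b) + 2) (\<lambda>s'. s' a = (right ^^ spine (s b)) (s a))"
  unfolding drop_prog_def
proof (rule reaches_While_count[where k = "spine (s b)" and T = 6 and
      I = "\<lambda>k s'. spine (s' b) = k \<and> (right ^^ k) (s' a) = (right ^^ spine (s b)) (s a)"])
  fix k s' assume "spine (s' b) = Suc k \<and> (right ^^ Suc k) (s' a) = (right ^^ spine (s b)) (s a)"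
  then show "eval (EVar b) s' \<noteq> Leaf \<and> reaches (Seq (Assign a (ERight (EVar a))) (Assign b (ERight (EVar b))))
      s' 6 (\<lambda>s'. spine (s' b) = k \<and> (right ^^ k) (s' a) = (right ^^ spine (s b)) (s a))"
    using assms
    by (auto intro!: reaches_Assign_Seq reaches_Assign simp: spine_right funpow_swap1)
qed (auto simp: spine_eq_0_iff)

section \<open>Covering value vectors by few row vectors\<close>

text \<open>Greedy choice: some element of \<open>Y\<close> takes care of at least the fraction
  \<open>p\<close> of what is still uncovered, so each round shrinks the rest by the factor
  \<open>1 - p\<close>.\<close>

lemma exists_almost_cover:
  fixes p :: real
  assumes fin: "finite X" "finite Y" "Y \<noteq> {}" and p: "0 \<le> p" "p \<le> 1"
    and deg: "\<And>x. x \<in> X \<Longrightarrow> p * card Y \<le> card {y \<in> Y. P x y}"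
  shows "\<exists>ys. set ys \<subseteq> Y \<and> length ys = k \<and>
           card {x \<in> X. \<forall>y \<in> set ys. \<not> P x y} \<le> card X * (1 - p) ^ k"
proof (induction k)
  case 0
  show ?case by (rule exI[of _ "[]"]) simp
next
  case (Suc k)
  then obtain ys where ys: "set ys \<subseteq> Y" "length ys = k"
    "card {x \<in> X. \<forall>y \<in> set ys. \<not> P x y} \<le> card X * (1 - p) ^ k" by blast
  define U where "U = {x \<in> X. \<forall>y \<in> set ys. \<not> P x y}"
  have finU: "finite U" using fin(1) by (simp add: U_def)
  \<comment> \<open>Count the pairs related by \<open>P\<close> between \<open>U\<close> and
    \<open>Y\<close> in both orders.\<close>
  have "\<exists>y \<in> Y. p * card U \<le> card {x \<in> U. P x y}"
  proof (rule ccontr)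
    assume "\<not> (\<exists>y \<in> Y. p * card U \<le> card {x \<in> U. P x y})"
    then have "(\<Sum>y \<in> Y. real (card {x \<in> U. P x y})) < (\<Sum>y \<in> Y. p * card U)"
      using fin by (intro sum_strict_mono) auto
    also have "\<dots> = (\<Sum>x \<in> U. p * card Y)" by simp
    also have "\<dots> \<le> (\<Sum>x \<in> U. real (card {y \<in> Y. P x y}))"
      by (rule sum_mono) (use deg in \<open>auto simp: U_def\<close>)
    also have "\<dots> = (\<Sum>y \<in> Y. real (card {x \<in> U. P x y}))"
      using sum.swap_restrict[OF finU fin(2), of "\<lambda>_ _. 1::real" P] by simp
    finally show False by simp
  qed
  then obtain y where y: "y \<in> Y" "p * card U \<le> card {x \<in> U. P x y}" by blast
  have "card U = card {x \<in> U. P x y} + card {x \<in> U. \<not> P x y}"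
    using finU by (subst card_Un_disjoint[symmetric]) (auto intro: arg_cong[where f = card])
  then have "real (card {x \<in> U. \<not> P x y}) \<le> card U * (1 - p)"
    using y(2) by (simp add: algebra_simps)
  also have "\<dots> \<le> card X * (1 - p) ^ k * (1 - p)"
    using ys(3) p by (intro mult_right_mono) (auto simp: U_def)
  also have "{x \<in> U. \<not> P x y} = {x \<in> X. \<forall>y \<in> set (y # ys). \<not> P x y}" by (auto simp: U_def)
  finally show ?case using ys y by (intro exI[of _ "y # ys"]) (auto simp: mult_ac)
qed

lemma card_list_all2:
  "card {ys. list_all2 R xs ys} = (\<Prod>x\<leftarrow>xs. card {y. R x y})"
proof (induction xs)
  case Nil
  have "{ys. list_all2 R [] ys} = {[]}" by auto
  then show ?case by simp
next
  case (Cons x xs)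
  have "{ys. list_all2 R (x # xs) ys} = (\<lambda>(y, ys). y # ys) ` ({y. R x y} \<times> {ys. list_all2 R xs ys})"
    by (auto simp: list_all2_Cons1)
  moreover have "inj_on (\<lambda>(y, ys). y # ys) ({y. R x y} \<times> {ys. list_all2 R xs ys})"
    by (auto simp: inj_on_def)
  ultimately show ?case using Cons by (simp add: card_image card_cartesian_product)
qed

text \<open>A row is named by its first residue. Wrapping around puts every value into equally many
  rows.\<close>

definition in_row :: "nat \<Rightarrow> nat \<Rightarrow> nat \<Rightarrow> nat \<Rightarrow> bool" where
  "in_row D d x j \<longleftrightarrow> j < D \<and> (\<exists>i < d. x = (j + i) mod D)"

lemma add_mod_inj:
  fixes j i i' D :: nat
  assumes "(j + i) mod D = (j + i') mod D" "i < D" "i' < D"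
  shows "i = i'"
proof -
  from assms(1) obtain q q' where "j + i + D * q = j + i' + D * q'" by (auto simp: nat_mod_eq_iff)
  then have "i + D * q = i' + D * q'" by simp
  then have "(i + D * q) mod D = (i' + D * q') mod D" by simp
  with assms(2,3) show ?thesis by simp
qed

lemma card_rows_ge:
  assumes "d \<le> D" "x < D"
  shows "d \<le> card {j. in_row D d x j}"
proof -
  have D: "D > 0" using assms by simp
  \<comment> \<open>The start of the row that has \<open>x\<close> in position \<open>i\<close>;
    writing \<open>D - i\<close> avoids truncated subtraction.\<close>
  let ?f = "\<lambda>i. (x + (D - i)) mod D"
  have undo: "(?f i + i) mod D = x" if "i < d" for i
  proof -
    have "(?f i + i) mod D = (x + (D - i) + i) mod D" by (simp add: mod_add_left_eq)
    also have "x + (D - i) + i = x + D" using that assms by simp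
    finally show ?thesis using assms by simp
  qed
  have "inj_on ?f {..<d}"
  proof (rule inj_onI)
    fix i i' assume i: "i \<in> {..<d}" "i' \<in> {..<d}" "?f i = ?f i'"
    define y where "y = ?f i"
    have "(y + i) mod D = (y + i') mod D"
      using undo[of i] undo[of i'] i unfolding y_def by simp
    moreover have "i < D" "i' < D" using i assms by auto
    ultimately show "i = i'" by (rule add_mod_inj)
  qed
  then have "d = card (?f ` {..<d})" by (simp add: card_image)
  also have "\<dots> \<le> card {j. in_row D d x j}"
  proof (rule card_mono)
    show "finite {j. in_row D d x j}" by (rule finite_subset[of _ "{..<D}"]) (auto simp: in_row_def)
    show "?f ` {..<d} \<subseteq> {j. in_row D d x j}" using D undo by (fastforce simp: in_row_def)
  qed
  finally show ?thesis .
qed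

text \<open>About \<open>q * ln D * (D / d) ^ q\<close> greedy rounds cover everything. Multiplied
  by \<open>(d - \<epsilon>) ^ q\<close> this is \<open>D ^ q * (q * y ^ q * ln D)\<close> with
  \<open>y < 1\<close>, and geometric decay beats the linear factor.\<close>

lemma exists_cheap_cover:
  fixes d D :: nat and \<epsilon> :: real
  assumes d: "0 < d" "d \<le> D" and eps: "0 < \<epsilon>" "\<epsilon> < d"
  shows "\<exists>q cs. q > 0 \<and> (\<forall>c \<in> set cs. length c = q) \<and>
    (\<forall>xs. length xs = q \<and> set xs \<subseteq> {..<D} \<longrightarrow> (\<exists>c \<in> set cs. list_all2 (in_row D d) xs c)) \<and>
    length cs * (d - \<epsilon>) ^ q < D ^ q"
proof -
  define y where "y = (d - \<epsilon>) / d"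
  have y: "0 < y" "y < 1" using eps by (auto simp: y_def)
  have D: "D > 0" "ln (real D) \<ge> 0" using d by auto
  \<comment> \<open>Relative to \<open>D ^ q\<close>, the first summand is the price of
    \<open>q * ln D / p\<close> vectors, and the second bounds the price of one more, from rounding
    up.\<close>
  have "(\<lambda>q. real q * y ^ q * ln D + y ^ q) \<longlonglongrightarrow> 0 * ln D + 0"
    using y by (intro tendsto_intros powser_times_n_limit_0 LIMSEQ_power_zero) auto
  then have "\<forall>\<^sub>F q in sequentially. real q * y ^ q * ln D + y ^ q < 1"
    by (intro order_tendstoD(2)[where y = 0]) auto
  then have "\<forall>\<^sub>F q in sequentially. real q * y ^ q * ln D + y ^ q < 1 \<and> q > 0"
    using eventually_gt_at_top[of 0] by (rule eventually_conj)
  then obtain q where q: "real q * y ^ q * ln D + y ^ q < 1" "q > 0"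
    by (auto simp: eventually_at_top_linorder)
  define p where "p = (d / D) ^ q"
  have p: "0 < p" "p \<le> 1" using d by (auto simp: p_def intro!: power_le_one)
  \<comment> \<open>For \<open>k > q * ln D / p\<close> the bound
    \<open>D ^ q * exp (- p * k)\<close> on the number of uncovered vectors is below 1, so none is
    left.\<close>
  define k where "k = nat \<lfloor>q * ln D / p\<rfloor> + 1"
  have k: "q * ln D / p < k" "k \<le> q * ln D / p + 1"
    unfolding k_def using D p by (simp_all, linarith+)
  let ?X = "{xs. set xs \<subseteq> {..<D} \<and> length xs = q}"
  have finX: "finite ?X" and cardX: "card ?X = D ^ q"
    by (auto simp: finite_lists_length_eq card_lists_length_eq)
  have neX: "?X \<noteq> {}" using cardX D by (metis card.empty power_not_zero not_gr_zero)
  have deg: "p * card ?X \<le> card {c \<in> ?X. list_all2 (in_row D d) xs c}" if "xs \<in> ?X" for xs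
  proof -
    have "d ^ length xs \<le> (\<Prod>x\<leftarrow>xs. card {j. in_row D d x j})"
      if "set xs \<subseteq> {..<D}" using that
      by (induction xs) (auto intro: mult_mono card_rows_ge[OF d(2)])
    moreover have "{c \<in> ?X. list_all2 (in_row D d) xs c} = {c. list_all2 (in_row D d) xs c}"
      using \<open>xs \<in> ?X\<close> by (auto simp: list_all2_conv_all_nth in_set_conv_nth in_row_def)
    ultimately have "d ^ q \<le> card {c \<in> ?X. list_all2 (in_row D d) xs c}"
      using \<open>xs \<in> ?X\<close> by (simp add: card_list_all2)
    moreover have "p * card ?X = real (d ^ q)" using D by (simp add: cardX p_def power_divide)
    ultimately show ?thesis by (simp del: of_nat_power)
  qed
  from exists_almost_cover[where P = "list_all2 (in_row D d)" and k = k,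
      OF finX finX neX less_imp_le[OF p(1)] p(2) deg] obtain cs
    where cs: "set cs \<subseteq> ?X" "length cs = k"
      "card {xs \<in> ?X. \<forall>c \<in> set cs. \<not> list_all2 (in_row D d) xs c} \<le> card ?X * (1 - p) ^ k"
    by auto
  have "card ?X * (1 - p) ^ k \<le> D ^ q * exp (- p) ^ k"
    using p exp_ge_add_one_self[of "- p"] by (auto simp: cardX intro!: mult_left_mono power_mono)
  also have "\<dots> = exp (q * ln D) * exp (- p * k)"
    using D by (simp add: exp_of_nat_mult exp_of_nat2_mult[symmetric])
  also have "\<dots> = exp (q * ln D - p * k)" by (simp add: exp_add[symmetric])
  also have "\<dots> < 1" using k(1) p(1) by (simp add: field_simps)
  finally have "card {xs \<in> ?X. \<forall>c \<in> set cs. \<not> list_all2 (in_row D d) xs c} = 0"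
    using cs(3) by simp
  then have none: "{xs \<in> ?X. \<forall>c \<in> set cs. \<not> list_all2 (in_row D d) xs c} = {}"
    using finX by (subst (asm) card_0_eq) (rule finite_subset[OF _ finX], auto)
  have "length cs * (d - \<epsilon>) ^ q \<le> (q * ln D / p + 1) * (d - \<epsilon>) ^ q"
    using cs(2) k(2) eps by (intro mult_right_mono) auto
  also have "\<dots> = D ^ q * (q * y ^ q * ln D) + (d - \<epsilon>) ^ q"
    using d by (simp add: p_def y_def power_divide field_simps)
  also have "(d - \<epsilon>) ^ q \<le> D ^ q * y ^ q"
  proof -
    have "1 * (d - \<epsilon>) \<le> D / d * (d - \<epsilon>)" using d eps by (intro mult_right_mono) auto
    then have "d - \<epsilon> \<le> D * y" by (simp add: y_def)
    then show ?thesis using eps by (simp add: power_mult_distrib[symmetric] power_mono)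
  qed
  also have "D ^ q * (q * y ^ q * ln D) + D ^ q * y ^ q = D ^ q * (q * y ^ q * ln D + y ^ q)"
    by (simp add: algebra_simps)
  also have "\<dots> < real (D ^ q) * 1" using q D by (intro mult_strict_left_mono) auto
  finally have "length cs * (d - \<epsilon>) ^ q < D ^ q" by simp
  with q(2) cs(1) none show ?thesis by (intro exI[of _ q] exI[of _ cs]) auto
qed

section \<open>From clauses to constraints\<close>

definition violated_by :: "constr set \<Rightarrow> (nat \<Rightarrow> nat) \<Rightarrow> constr set" where
  "violated_by C \<alpha> = {(xs, R) \<in> C. map \<alpha> xs \<notin> R}"

text \<open>The constraints violated by \<open>\<alpha>\<close> form a feasible deletion
  set.\<close>

lemma max_csp_le:
  assumes "\<alpha> \<in> {..<n} \<rightarrow> {1..d}"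
  shows "max_csp d n C \<le> card (violated_by C \<alpha>)"
  unfolding max_csp_def
  by (rule Least_le, rule exI[of _ "violated_by C \<alpha>"])
    (use assms in \<open>auto simp: violated_by_def csp_satisfiable_def\<close>)

text \<open>An assignment that satisfies what an optimal deletion leaves over violates only deleted
  constraints.\<close>

lemma max_csp_attained:
  assumes "finite C" "d \<ge> 1"
  obtains \<alpha> where "\<alpha> \<in> {..<n} \<rightarrow> {1..d}" "max_csp d n C = card (violated_by C \<alpha>)"
proof -
  \<comment> \<open>Deleting everything is feasible, so the \<open>LEAST\<close> in
    \<open>max_csp\<close> is attained; \<open>d \<ge> 1\<close> provides an assignment.\<close>
  have "csp_satisfiable d n (C - C)"
    using assms(2) by (auto simp: csp_satisfiable_def intro!: bexI[of _ "\<lambda>_. 1"])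
  then have "\<exists>k. \<exists>D \<subseteq> C. card D = k \<and> csp_satisfiable d n (C - D)" by blast
  from LeastI_ex[OF this] obtain D where
    D: "D \<subseteq> C" "card D = max_csp d n C" "csp_satisfiable d n (C - D)"
    unfolding max_csp_def by blast
  then obtain \<alpha> where \<alpha>: "\<alpha> \<in> {..<n} \<rightarrow> {1..d}" "\<forall>(xs, R) \<in> C - D. map \<alpha> xs \<in> R"
    by (auto simp: csp_satisfiable_def)
  then have "violated_by C \<alpha> \<subseteq> D" by (auto simp: violated_by_def)
  then have "card (violated_by C \<alpha>) \<le> max_csp d n C"
    using D assms(1) by (metis card_mono finite_subset)
  with max_csp_le[OF \<alpha>(1), of C] \<alpha>(1) that show ?thesis by (meson le_antisym)
qed

text \<open>Clauses stay lists, because \<open>[(v, x), (v, x)]\<close> has to count separately from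
  the unit clause with the same set of literals.\<close>

definition num_violated :: "literal list list \<Rightarrow> (nat \<Rightarrow> bool) \<Rightarrow> nat" where
  "num_violated cs \<beta> = length (filter (\<lambda>c. \<forall>l \<in> set c. \<beta> (fst l) \<noteq> snd l) cs)"

definition min_violated :: "literal list list \<Rightarrow> nat" where
  "min_violated cs = Inf (range (num_violated cs))"

lemma min_violated_le: "min_violated cs \<le> num_violated cs \<beta>"
  unfolding min_violated_def by (rule cInf_lower) auto

lemma min_violated_attained:
  obtains \<beta> where "num_violated cs \<beta> = min_violated cs"
  using Inf_nat_def1[of "range (num_violated cs)"] unfolding min_violated_def by force

text \<open>A new block goes in front of an old branch, and new branches in front of the
  accumulator: the order in which a program can cons.\<close>

fun branches :: "nat list list \<Rightarrow> nat \<Rightarrow> nat list list" where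
  "branches covs 0 = [[]]"
| "branches covs (Suc t) = fold (\<lambda>js acc. map (\<lambda>c. c @ js) covs @ acc) (branches covs t) []"

lemma set_fold_append: "set (fold (\<lambda>x acc. f x @ acc) xs ys) = set ys \<union> (\<Union>x \<in> set xs. set (f x))"
  by (induction xs arbitrary: ys) auto

lemma length_fold_append:
  "(\<And>x. length (f x) = k) \<Longrightarrow> length (fold (\<lambda>x acc. f x @ acc) xs ys) = length ys + k * length xs"
  by (induction xs arbitrary: ys) auto

lemma length_branches: "length (branches covs t) = length covs ^ t"
  by (induction t) (auto simp: length_fold_append[where k = "length covs"])

lemma length_of_branch:
  "js \<in> set (branches covs t) \<Longrightarrow> (\<And>c. c \<in> set covs \<Longrightarrow> length c = q) \<Longrightarrow> length js = t * q"
  by (induction t arbitrary: js) (auto simp: set_fold_append)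

lemma branches_cover:
  assumes cov: "\<And>xs. length xs = q \<Longrightarrow> set xs \<subseteq> A \<Longrightarrow> \<exists>c \<in> set covs. list_all2 R xs c"
    and "length xs = t * q" "set xs \<subseteq> A"
  shows "\<exists>js \<in> set (branches covs t). list_all2 R xs js"
  using assms(2,3)
proof (induction t arbitrary: xs)
  case (Suc t)
  from Suc.prems have "length (take q xs) = q" "set (take q xs) \<subseteq> A"
    by (auto dest: in_set_takeD)
  from cov[OF this] obtain c where c: "c \<in> set covs" "list_all2 R (take q xs) c" by blast
  from Suc.prems have "length (drop q xs) = t * q" "set (drop q xs) \<subseteq> A"
    by (auto dest: in_set_dropD)
  from Suc.IH[OF this] obtain js where js: "js \<in> set (branches covs t)" "list_all2 R (drop q xs) js"
    by blast
  have "list_all2 R xs (c @ js)" using list_all2_appendI[OF c(2) js(2)] by simp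
  with c js show ?case by (auto simp: set_fold_append)
qed auto

section \<open>Tables, relations, and the separation of constraints\<close>

locale branching =
  fixes d b :: nat
  assumes d_ge_2: "2 \<le> d" and d_le: "d \<le> 2 ^ b" and d_gt_half: "2 ^ b < 2 * d"
begin

definition truth :: "nat \<Rightarrow> nat \<Rightarrow> bool list" where
  "truth j k = map (\<lambda>i. bit ((j + i) mod 2 ^ b) k) [0..<d]"

text \<open>Entry \<open>v\<close> gives the CSP variable and the truth table of Boolean variable
  \<open>v\<close>. Groups are numbered from the end, so prefixing a block leaves the existing
  entries unchanged.\<close>

fun tab :: "nat list \<Rightarrow> (nat \<times> bool list) list" where
  "tab [] = []"
| "tab (j # js) = map (\<lambda>k. (length js, truth j k)) [0..<b] @ tab js"

lemma b_pos: "b > 0"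
  using d_ge_2 d_le by (cases b) auto

lemma length_tab [simp]: "length (tab js) = b * length js"
  by (induction js) auto

lemma nth_tab:
  "v < b * length js \<Longrightarrow>
    tab js ! v = (length js - 1 - v div b, truth (js ! (v div b)) (v mod b))"
proof (induction js arbitrary: v)
  case (Cons j js)
  show ?case
  proof (cases "v < b")
    case True
    then show ?thesis by (simp add: nth_append)
  next
    case False
    then have "v div b = Suc ((v - b) div b)" "v mod b = (v - b) mod b"
      using b_pos by (simp_all add: le_div_geq le_mod_geq)
    with False Cons show ?thesis by (simp add: nth_append)
  qed
qed simp

text \<open>A key keeps only truth tables and signs, not the variables. Each literal has its own
  position even if groups repeat, so the excluded tuples always form a full product. Domain values
  start at 1 and list positions at 0, hence \<open>as ! i - 1\<close>.\<close>

definition rel :: "(bool list \<times> bool) list \<Rightarrow> nat list list" where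
  "rel ks = filter (\<lambda>as. \<exists>i < length ks. fst (ks ! i) ! (as ! i - 1) = snd (ks ! i))
              (List.n_lists (length ks) [1..<Suc d])"

text \<open>The reversal, here and in \<open>key\<close>, anticipates a loop that conses one literal
  after the other.\<close>

definition scope :: "nat list \<Rightarrow> literal list \<Rightarrow> nat list" where
  "scope js c = map (\<lambda>l. fst (tab js ! fst l)) (rev c)"

definition key :: "nat list \<Rightarrow> literal list \<Rightarrow> (bool list \<times> bool) list" where
  "key js c = map (\<lambda>l. (snd (tab js ! fst l), snd l)) (rev c)"

definition constraint :: "nat list \<Rightarrow> literal list \<Rightarrow> nat list \<times> nat list list" where
  "constraint js c = (scope js c, rel (key js c))"

definition instance_of :: "nat list \<Rightarrow> literal list list \<Rightarrow> constr set" where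
  "instance_of js cs = (\<lambda>(xs, L). (xs, set L)) ` set (map (constraint js) cs)"

text \<open>Weaker than the input format: literals may repeat within a clause, and different clauses
  may have the same set of literals. The self-reduction needs both.\<close>

definition valid :: "nat \<Rightarrow> literal list list \<Rightarrow> bool" where
  "valid n cs \<longleftrightarrow> distinct cs \<and> (\<forall>c \<in> set cs. length c \<le> 3 \<and> (\<forall>l \<in> set c. fst l < n))"

definition asg :: "nat list \<Rightarrow> (nat \<Rightarrow> nat) \<Rightarrow> nat \<Rightarrow> bool" where
  "asg js \<alpha> v = snd (tab js ! v) ! (\<alpha> (fst (tab js ! v)) - 1)"

lemma set_rel:
  "as \<in> set (rel ks) \<longleftrightarrow> length as = length ks \<and> set as \<subseteq> {1..d} \<and>
     (\<exists>i < length ks. fst (ks ! i) ! (as ! i - 1) = snd (ks ! i))"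
  by (auto simp: rel_def set_n_lists atLeastLessThanSuc_atLeastAtMost)

lemma distinct_rel: "distinct (rel ks)"
  unfolding rel_def by (intro distinct_filter distinct_n_lists) simp

text \<open>Flipping bit \<open>k\<close> is a bijection, so a predicate that it negates holds on exactly half of the
  values, and the complement is too small to contain a row.\<close>

lemma row_meets_half:
  fixes P :: "nat \<Rightarrow> bool"
  assumes "k < b" and flip: "\<And>x. P (flip_bit k x) \<longleftrightarrow> \<not> P x"
  shows "\<exists>i < d. P ((j + i) mod 2 ^ b)"
proof (rule ccontr)
  assume none: "\<not> (\<exists>i < d. P ((j + i) mod 2 ^ b))"
  let ?S = "(\<lambda>i. (j + i) mod 2 ^ b) ` {..<d}"
  have "inj_on (\<lambda>i. (j + i) mod 2 ^ b) {..<d}"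
  proof (rule inj_onI)
    fix i i' assume "i \<in> {..<d}" "i' \<in> {..<d}" "(j + i) mod 2 ^ b = (j + i') mod 2 ^ b"
    then show "i = i'" using d_le by (intro add_mod_inj[of j i "2 ^ b" i']) auto
  qed
  then have cS: "card ?S = d" by (simp add: card_image)
  have inv: "flip_bit k (flip_bit k x) = x" for x :: nat
    by (rule bit_eqI) (auto simp: bit_flip_bit_iff)
  have "inj_on (flip_bit k) ?S" by (rule inj_on_inverseI[of _ "flip_bit k"]) (rule inv)
  then have cF: "card (flip_bit k ` ?S) = d" using cS by (simp add: card_image)
  have "\<not> P x" if "x \<in> ?S" for x using none that by auto
  moreover from this have "P x" if "x \<in> flip_bit k ` ?S" for x using flip that by blast
  ultimately have "?S \<inter> flip_bit k ` ?S = {}" by blast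
  then have "card (?S \<union> flip_bit k ` ?S) = 2 * d" using cS cF by (simp add: card_Un_disjoint)
  moreover have "?S \<union> flip_bit k ` ?S \<subseteq> {..<2 ^ b}"
  proof -
    have "flip_bit k x < 2 ^ b" if "x < 2 ^ b" for x :: nat
      using that assms(1) by (metis take_bit_flip_bit_eq take_bit_nat_eq_self_iff not_le)
    then show ?thesis by auto
  qed
  then have "card (?S \<union> flip_bit k ` ?S) \<le> 2 ^ b" by (metis card_lessThan card_mono finite_lessThan)
  ultimately show False using d_gt_half by simp
qed

text \<open>Flipping bit \<open>k\<close> negates the literal, so the literal cannot be true on a
  whole row.\<close>

lemma exists_false:
  assumes "k < b"
  shows "\<exists>a \<in> {1..d}. truth j k ! (a - 1) \<noteq> s"
proof -
  from row_meets_half[OF assms, of "\<lambda>x. bit x k \<noteq> s" j] obtain i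
    where "i < d" "bit ((j + i) mod 2 ^ b) k \<noteq> s" by (auto simp: bit_flip_bit_iff)
  then show ?thesis by (intro bexI[of _ "Suc i"]) (auto simp: truth_def)
qed

text \<open>For different bits, flipping bit \<open>k\<close> negates the exclusive or of the two
  literals, so they disagree somewhere on the row. For the same bit the signs differ, and they
  disagree everywhere.\<close>

lemma false_sets_differ:
  assumes "k < b" "k' < b" "(k, s) \<noteq> (k', s')"
  shows "\<exists>a \<in> {1..d}. (truth j k ! (a - 1) \<noteq> s) \<noteq> (truth j k' ! (a - 1) \<noteq> s')"
proof (cases "k = k'")
  case True
  with assms d_ge_2 show ?thesis by (intro bexI[of _ 1]) auto
next
  case False
  with row_meets_half[OF assms(1), of "\<lambda>x. (bit x k \<noteq> s) \<noteq> (bit x k' \<noteq> s')" j] obtain i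
    where "i < d" "(bit ((j + i) mod 2 ^ b) k \<noteq> s) \<noteq> (bit ((j + i) mod 2 ^ b) k' \<noteq> s')"
    by (auto simp: bit_flip_bit_iff)
  then show ?thesis by (intro bexI[of _ "Suc i"]) (auto simp: truth_def)
qed

text \<open>The complement of the relation is the product of the sets where the single literals are false;
  as these are nonempty, the product determines them.\<close>

lemma constraint_inj:
  assumes c: "\<forall>l \<in> set c. fst l < b * length js" "\<forall>l \<in> set c'. fst l < b * length js"
    and eq: "scope js c = scope js c'" "set (rel (key js c)) = set (rel (key js c'))"
  shows "c = c'"
proof -
  define m where "m = length c"
  have len: "length c' = m" using arg_cong[OF eq(1), of length] by (simp add: scope_def m_def)
  define e where "e = rev c"
  define e' where "e' = rev c'"
  have le: "length e = m" "length e' = m" using len by (auto simp: e_def e'_def m_def)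
  have bd: "fst (e ! i) < b * length js" "fst (e' ! i) < b * length js" if "i < m" for i
    using that le c nth_mem[of i e] nth_mem[of i e'] by (auto simp: e_def e'_def)
  define F where "F = (\<lambda>i a. snd (tab js ! fst (e ! i)) ! (a - 1) \<noteq> snd (e ! i))"
  define F' where "F' = (\<lambda>i a. snd (tab js ! fst (e' ! i)) ! (a - 1) \<noteq> snd (e' ! i))"
  have key: "length (key js c) = m" "length (key js c') = m"
    "\<And>i. i < m \<Longrightarrow> key js c ! i = (snd (tab js ! fst (e ! i)), snd (e ! i))"
    "\<And>i. i < m \<Longrightarrow> key js c' ! i = (snd (tab js ! fst (e' ! i)), snd (e' ! i))"
    using le by (auto simp: key_def e_def e'_def)
  have prod: "(\<forall>i < m. F i (as ! i)) \<longleftrightarrow> (\<forall>i < m. F' i (as ! i))"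
    if "length as = m" "set as \<subseteq> {1..d}" for as
  proof -
    have "as \<in> set (rel (key js c)) \<longleftrightarrow> as \<in> set (rel (key js c'))" using eq(2) by simp
    then show ?thesis using that key by (auto simp: set_rel F_def F'_def)
  qed
  have "\<exists>a. a \<in> {1..d} \<and> F i a" if "i < m" for i
    using exists_false[of "fst (e ! i) mod b" "js ! (fst (e ! i) div b)" "snd (e ! i)"] b_pos
      nth_tab[OF bd(1)[OF that]] by (auto simp: F_def)
  then obtain w where w: "\<And>i. i < m \<Longrightarrow> w i \<in> {1..d} \<and> F i (w i)" by metis
  define ws where "ws = map w [0..<m]"
  have ws: "length ws = m" "set ws \<subseteq> {1..d}" "\<And>i. i < m \<Longrightarrow> ws ! i = w i"
    using w by (auto simp: ws_def)
  \<comment> \<open>\<open>ws\<close> falsifies all literals of \<open>c\<close> and, as the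
    products agree, all those of \<open>c'\<close>. Changing one coordinate of \<open>ws\<close>
    then isolates one factor of both products.\<close>
  have F'w: "\<forall>i < m. F' i (ws ! i)" using prod[OF ws(1,2)] w ws(3) by auto
  have FF': "F i a \<longleftrightarrow> F' i a" if "i < m" "a \<in> {1..d}" for i a
  proof -
    have "set (ws[i := a]) \<subseteq> {1..d}" using ws(2) that(2) set_update_subset_insert[of ws i a] by blast
    then have "(\<forall>k < m. F k (ws[i := a] ! k)) \<longleftrightarrow> (\<forall>k < m. F' k (ws[i := a] ! k))"
      using ws(1) by (intro prod) auto
    moreover have "(\<forall>k < m. F k (ws[i := a] ! k)) \<longleftrightarrow> F i a"
      using w ws(1,3) that(1) by (auto simp: nth_list_update)
    moreover have "(\<forall>k < m. F' k (ws[i := a] ! k)) \<longleftrightarrow> F' i a"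
      using F'w ws(1) that(1) by (auto simp: nth_list_update)
    ultimately show ?thesis by simp
  qed
  have "e ! i = e' ! i" if i: "i < m" for i
  proof -
    let ?v = "fst (e ! i)" and ?v' = "fst (e' ! i)"
    \<comment> \<open>The scope determines the group of each literal; bit and sign have to come from
      the set of values where it is false.\<close>
    have "fst (tab js ! ?v) = fst (tab js ! ?v')"
      using arg_cong[OF eq(1), of "\<lambda>xs. xs ! i"] i le by (simp add: scope_def e_def e'_def)
    moreover have "?v div b < length js" "?v' div b < length js"
      using bd[OF i] b_pos by (simp_all add: div_less_iff_less_mult mult.commute)
    ultimately have dv: "?v div b = ?v' div b" using bd[OF i] by (simp add: nth_tab)
    have "(?v mod b, snd (e ! i)) = (?v' mod b, snd (e' ! i))"
    proof (rule ccontr)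
      assume "(?v mod b, snd (e ! i)) \<noteq> (?v' mod b, snd (e' ! i))"
      from false_sets_differ[OF mod_less_divisor[OF b_pos] mod_less_divisor[OF b_pos] this,
          of "js ! (?v div b)"] obtain a where
        a: "a \<in> {1..d}" "(truth (js ! (?v div b)) (?v mod b) ! (a - 1) \<noteq> snd (e ! i)) \<noteq>
          (truth (js ! (?v div b)) (?v' mod b) ! (a - 1) \<noteq> snd (e' ! i))" by (rule bexE)
      then have "F i a \<noteq> F' i a" using bd[OF i] dv by (simp only: F_def F'_def nth_tab snd_conv not_False_eq_True)
      with FF'[OF i a(1)] show False by simp
    qed
    with dv show ?thesis by (metis div_mult_mod_eq prod.collapse prod.inject)
  qed
  then have "e = e'" using le by (intro nth_equalityI) auto
  then show ?thesis by (simp add: e_def e'_def)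
qed

lemma constraint_inj_on:
  assumes "valid n cs" "n \<le> b * length js"
  shows "inj_on (\<lambda>c. (scope js c, set (rel (key js c)))) (set cs)"
  using assms by (intro inj_onI constraint_inj[of _ js]) (fastforce simp: valid_def)+

lemma tab_fst_less: "v < b * length js \<Longrightarrow> fst (tab js ! v) < length js"
  by (cases "js = []") (auto simp: nth_tab)

lemma csp_instance_instance_of:
  assumes "valid n cs" "n \<le> b * length js"
  shows "csp_instance d 3 (length js) (instance_of js cs)"
  using assms
  by (fastforce simp: csp_instance_def instance_of_def constraint_def valid_def scope_def key_def
      set_rel intro!: tab_fst_less)

lemma csp_input_instance_of:
  assumes "valid n cs" "n \<le> b * length js"
  shows "csp_input (length js) (instance_of js cs)
    (Node (enc_nat (length js)) (enc_list (enc_pair (enc_list enc_nat) (enc_list (enc_list enc_nat)))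
       (rev (map (constraint js) cs))))"
  unfolding csp_input_def
proof (intro exI[of _ "rev (map (constraint js) cs)"] conjI)
  have "distinct (map (\<lambda>c. (scope js c, set (rel (key js c)))) cs)"
    using constraint_inj_on[OF assms] assms(1) by (simp add: distinct_map valid_def)
  then show "distinct (map (\<lambda>(xs, L). (xs, set L)) (rev (map (constraint js) cs)))"
    by (simp add: rev_map[symmetric] comp_def constraint_def)
qed (auto simp: instance_of_def constraint_def distinct_rel)

text \<open>A constraint fails exactly when its clause does, and injectivity prevents violated
  clauses from merging in the set of constraints.\<close>

lemma card_violated_by_instance_of:
  assumes cs: "valid n cs" "n \<le> b * length js" and \<alpha>: "\<alpha> \<in> {..<length js} \<rightarrow> {1..d}"
  shows "card (violated_by (instance_of js cs) \<alpha>) = num_violated cs (asg js \<alpha>)"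
proof -
  let ?f = "\<lambda>c. (scope js c, set (rel (key js c)))"
  have sat: "map \<alpha> (scope js c) \<in> set (rel (key js c)) \<longleftrightarrow> (\<exists>l \<in> set c. asg js \<alpha> (fst l) = snd l)"
    if "c \<in> set cs" for c
  proof -
    have "set (map \<alpha> (scope js c)) \<subseteq> {1..d}"
    proof -
      have "set (scope js c) \<subseteq> {..<length js}"
        using cs that by (fastforce simp: scope_def valid_def intro!: tab_fst_less)
      then show ?thesis using \<alpha> by auto
    qed
    moreover have "(\<exists>l \<in> set c. asg js \<alpha> (fst l) = snd l) \<longleftrightarrow>
        (\<exists>i < length (rev c). asg js \<alpha> (fst (rev c ! i)) = snd (rev c ! i))"
      by (metis in_set_conv_nth set_rev)
    ultimately show ?thesis by (auto simp: set_rel scope_def key_def asg_def)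
  qed
  have "violated_by (instance_of js cs) \<alpha> = ?f ` {c \<in> set cs. \<forall>l \<in> set c. asg js \<alpha> (fst l) \<noteq> snd l}"
    using sat by (force simp: violated_by_def instance_of_def constraint_def)
  moreover have "inj_on ?f {c \<in> set cs. \<forall>l \<in> set c. asg js \<alpha> (fst l) \<noteq> snd l}"
    using constraint_inj_on[OF cs] by (rule inj_on_subset) auto
  moreover have "card {c \<in> set cs. \<forall>l \<in> set c. asg js \<alpha> (fst l) \<noteq> snd l} = num_violated cs (asg js \<alpha>)"
    using cs(1) distinct_card[of "filter (\<lambda>c. \<forall>l \<in> set c. asg js \<alpha> (fst l) \<noteq> snd l) cs"]
    by (simp add: num_violated_def valid_def)
  ultimately show ?thesis by (simp add: card_image)
qed

section \<open>Every Boolean assignment lies in some branch\<close>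

definition group_value :: "(nat \<Rightarrow> bool) \<Rightarrow> nat \<Rightarrow> nat" where
  "group_value \<beta> k = horner_sum of_bool 2 (map (\<lambda>i. \<beta> (b * k + i)) [0..<b])"

lemma group_value_less: "group_value \<beta> k < 2 ^ b"
  using horner_sum_of_bool_2_less[of "map (\<lambda>i. \<beta> (b * k + i)) [0..<b]"]
  by (simp add: group_value_def)

lemma bit_group_value: "v < b * N \<Longrightarrow> bit (group_value \<beta> (v div b)) (v mod b) = \<beta> v"
  using b_pos by (simp add: group_value_def bit_horner_sum_bit_iff)

text \<open>If the row of each group contains the value of that group, its position in the row is
  the CSP value to choose.\<close>

lemma asg_surj:
  assumes "list_all2 (in_row (2 ^ b) d) (map (group_value \<beta>) [0..<length js]) js"
  obtains \<alpha> where "\<alpha> \<in> {..<length js} \<rightarrow> {1..d}" "\<And>v. v < b * length js \<Longrightarrow> asg js \<alpha> v = \<beta> v"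
proof -
  have "\<forall>k. \<exists>i. k < length js \<longrightarrow> i < d \<and> group_value \<beta> k = (js ! k + i) mod 2 ^ b"
    using assms by (auto simp: list_all2_conv_all_nth in_row_def)
  then obtain f where f: "\<And>k. k < length js \<Longrightarrow> f k < d \<and> group_value \<beta> k = (js ! k + f k) mod 2 ^ b"
    by metis
  \<comment> \<open>The subtraction undoes the numbering of groups from the end in
    \<open>tab\<close>; \<open>Suc\<close> turns positions into domain values.\<close>
  define \<alpha> where "\<alpha> = (\<lambda>g. Suc (f (length js - 1 - g)))"
  have "asg js \<alpha> v = \<beta> v" if "v < b * length js" for v
  proof -
    have k: "v div b < length js" using that b_pos by (simp add: div_less_iff_less_mult mult.commute)
    then have "asg js \<alpha> v = truth (js ! (v div b)) (v mod b) ! f (v div b)"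
      using that by (simp add: asg_def nth_tab \<alpha>_def)
    also have "\<dots> = bit (group_value \<beta> (v div b)) (v mod b)" using f[OF k] by (simp add: truth_def)
    finally show ?thesis using bit_group_value[OF that] by simp
  qed
  moreover have "\<alpha> \<in> {..<length js} \<rightarrow> {1..d}" using f by (fastforce simp: \<alpha>_def Suc_le_eq)
  ultimately show ?thesis using that by blast
qed

lemma num_violated_cong:
  "valid n cs \<Longrightarrow> (\<And>v. v < n \<Longrightarrow> \<beta> v = \<gamma> v) \<Longrightarrow> num_violated cs \<beta> = num_violated cs \<gamma>"
  unfolding num_violated_def valid_def by (intro arg_cong[where f = length] filter_cong) fastforce+

text \<open>Some branch contains an optimal assignment, and optima of branches decode to
  assignments, so neither direction fails. The start value \<open>length cs\<close> is harmless
  because no assignment violates more clauses.\<close>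

lemma min_violated_eq:
  assumes covs: "\<And>c. c \<in> set covs \<Longrightarrow> length c = q"
    "\<And>xs. length xs = q \<Longrightarrow> set xs \<subseteq> {..<2 ^ b} \<Longrightarrow> \<exists>c \<in> set covs. list_all2 (in_row (2 ^ b) d) xs c"
    and cs: "valid n cs" "n \<le> b * (t * q)"
  shows "fold min (map (\<lambda>js. max_csp d (t * q) (instance_of js cs)) (branches covs t)) (length cs)
    = min_violated cs" (is "fold min (map ?val ?br) _ = _")
proof -
  have br: "length js = t * q" if "js \<in> set ?br" for js using length_of_branch[OF that covs(1)] .
  have "fold min (map ?val ?br) (length cs) = Min (insert (length cs) (?val ` set ?br))"
    using Min.set_eq_fold[of "length cs" "map ?val ?br"] by simp
  also have "\<dots> = min_violated cs"
  proof (rule antisym)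
    obtain \<beta> where \<beta>: "num_violated cs \<beta> = min_violated cs" by (rule min_violated_attained)
    have "\<exists>js \<in> set ?br. list_all2 (in_row (2 ^ b) d) (map (group_value \<beta>) [0..<t * q]) js"
      by (rule branches_cover[OF covs(2)]) (auto simp: group_value_less)
    then obtain js where js: "js \<in> set ?br"
      "list_all2 (in_row (2 ^ b) d) (map (group_value \<beta>) [0..<length js]) js" using br by metis
    from asg_surj[OF js(2)] obtain \<alpha> where \<alpha>: "\<alpha> \<in> {..<length js} \<rightarrow> {1..d}"
      "\<And>v. v < b * length js \<Longrightarrow> asg js \<alpha> v = \<beta> v" by blast
    have cs': "n \<le> b * length js" using cs(2) br[OF js(1)] by simp
    have "?val js \<le> num_violated cs (asg js \<alpha>)"
      using max_csp_le[OF \<alpha>(1), of "instance_of js cs"] br[OF js(1)]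
        card_violated_by_instance_of[OF cs(1) cs' \<alpha>(1)] by simp
    also have "\<dots> = min_violated cs"
      using \<beta> num_violated_cong[OF cs(1), of "asg js \<alpha>" \<beta>] \<alpha>(2) cs' by simp
    finally have "?val js \<le> min_violated cs" .
    moreover have "Min (insert (length cs) (?val ` set ?br)) \<le> ?val js" using js(1) by (intro Min_le) auto
    ultimately show "Min (insert (length cs) (?val ` set ?br)) \<le> min_violated cs" by simp
  next
    have "min_violated cs \<le> length cs"
      using min_violated_le[of cs undefined] by (rule le_trans) (simp add: num_violated_def)
    moreover have "min_violated cs \<le> ?val js" if "js \<in> set ?br" for js
    proof -
      have cs': "n \<le> b * length js" using cs(2) br[OF that] by simp
      obtain \<alpha> where \<alpha>: "\<alpha> \<in> {..<length js} \<rightarrow> {1..d}"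
        "max_csp d (length js) (instance_of js cs) = card (violated_by (instance_of js cs) \<alpha>)"
        by (rule max_csp_attained[of "instance_of js cs" d "length js"])
          (use d_ge_2 in \<open>auto simp: instance_of_def\<close>)
      then show ?thesis
        using card_violated_by_instance_of[OF cs(1) cs' \<alpha>(1)] min_violated_le br[OF that] by simp
    qed
    ultimately show "min_violated cs \<le> Min (insert (length cs) (?val ` set ?br))" by simp
  qed
  finally show ?thesis .
qed

end

section \<open>The Max 3-Sat algorithm\<close>

lemma enc_pair_eq: "enc_pair f g l = Node (f (fst l)) (g (snd l))"
  by (cases l) simp

abbreviation enc_clause :: "literal list \<Rightarrow> tree" where
  "enc_clause \<equiv> enc_list (enc_pair enc_nat enc_bool)"

abbreviation enc_tab :: "(nat \<times> bool list) list \<Rightarrow> tree" where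
  "enc_tab \<equiv> enc_list (enc_pair enc_nat (enc_list enc_bool))"

abbreviation enc_key :: "(bool list \<times> bool) list \<Rightarrow> tree" where
  "enc_key \<equiv> enc_list (enc_pair (enc_list enc_bool) enc_bool)"

abbreviation enc_csp :: "(nat list \<times> nat list list) list \<Rightarrow> tree" where
  "enc_csp \<equiv> enc_list (enc_pair (enc_list enc_nat) (enc_list (enc_list enc_nat)))"

lemma num_violated_append: "num_violated (cs @ cs') \<beta> = num_violated cs \<beta> + num_violated cs' \<beta>"
  by (simp add: num_violated_def)

text \<open>
  Clauses are listed without repeated literals, so the lists below differ from all clauses and, by
  injectivity, stay separate constraints.
\<close>

definition fixing :: "(nat \<Rightarrow> bool) \<Rightarrow> nat list \<Rightarrow> literal list list" where
  "fixing \<beta> vs = map (\<lambda>v. [(v, \<beta> v), (v, \<beta> v)]) vs"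

lemma num_violated_fixing_eq_0:
  "num_violated (fixing \<beta> vs) \<gamma> = 0 \<longleftrightarrow> (\<forall>v \<in> set vs. \<gamma> v = \<beta> v)"
  by (auto simp: num_violated_def fixing_def filter_empty_conv)

text \<open>
  The program \<open>p\<close> for Max-CSP owns the variables up to \<open>V\<close>, the algorithm those above. The program \<open>lk\<close>
  tabulates \<open>rel\<close>, which is possible because keys of length at most three form a finite set.
\<close>

locale reduction = branching +
  fixes covs :: "nat list list" and q :: nat and p :: prog and V :: nat and Tp :: "nat \<Rightarrow> nat"
    and lk :: prog and Tl :: nat
  assumes q_pos: "q > 0"
    and covs_length: "\<And>c. c \<in> set covs \<Longrightarrow> length c = q"
    and covs_cover: "\<And>xs. length xs = q \<Longrightarrow> set xs \<subseteq> {..<2 ^ b} \<Longrightarrow>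
        \<exists>c \<in> set covs. list_all2 (in_row (2 ^ b) d) xs c"
    and p_vars: "prog_vars p \<subseteq> {..V}"
    and p_solves: "\<And>n C x. csp_instance d 3 n C \<Longrightarrow> csp_input n C x \<Longrightarrow>
        \<exists>t \<le> Tp n. runs p x t (enc_nat (max_csp d n C))"
    and lk_writes: "writes lk = {V + 16}"
    and lk_reaches: "\<And>s ks. s (V + 13) = enc_key ks \<Longrightarrow> length ks \<le> 3 \<Longrightarrow>
        (\<And>k. k \<in> set ks \<Longrightarrow> length (fst k) = d) \<Longrightarrow>
        reaches lk s Tl (\<lambda>s'. s' (V + 16) = enc_list (enc_list enc_nat) (rel ks))"
begin

text \<open>\<open>vTables\<close> keeps the tables of all branches, and \<open>vTable\<close> is
  the unprocessed rest of this list, so its head is the table of the current branch. The spine of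
  \<open>vBest\<close> is the least value so far, that of \<open>vTarget\<close> the optimum of the
  input formula.\<close>

abbreviation (input) "vGroups \<equiv> V + 19"
abbreviation (input) "vTables \<equiv> V + 20"
abbreviation (input) "vClauses \<equiv> V + 3"
abbreviation (input) "vTarget \<equiv> V + 4"
abbreviation (input) "vOutput \<equiv> V + 5"
abbreviation (input) "vCounter \<equiv> V + 6"
abbreviation (input) "vBest \<equiv> V + 7"
abbreviation (input) "vTable \<equiv> V + 8"
abbreviation (input) "vClause \<equiv> V + 9"
abbreviation (input) "vConstraints \<equiv> V + 10"
abbreviation (input) "vLiteral \<equiv> V + 11"
abbreviation (input) "vScope \<equiv> V + 12"
abbreviation (input) "vKey \<equiv> V + 13"
abbreviation (input) "vPointer \<equiv> V + 14"
abbreviation (input) "vSteps \<equiv> V + 15"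
abbreviation (input) "vRelation \<equiv> V + 16"
abbreviation (input) "vNew \<equiv> V + 17"
abbreviation (input) "vNum \<equiv> V + 18"

section \<open>Writing down the Max-CSP instance of one branch\<close>

definition literal_prog :: prog where
  "literal_prog =
    Seq (Assign vPointer (ELeft (EVar vTable)))
   (Seq (Assign vSteps (ELeft (ELeft (EVar vLiteral))))
   (Seq (drop_prog vPointer vSteps)
   (Seq (Assign vScope (ENode (ELeft (ELeft (EVar vPointer))) (EVar vScope)))
   (Seq (Assign vKey (ENode (ENode (ERight (ELeft (EVar vPointer))) (ERight (ELeft (EVar vLiteral)))) (EVar vKey)))
        (Assign vLiteral (ERight (EVar vLiteral)))))))"

lemma writes_literal_prog [simp]: "writes literal_prog = {vPointer, vSteps, vScope, vKey, vLiteral}"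
  by (auto simp: literal_prog_def writes_drop_prog)

lemma reaches_literal_prog:
  assumes s: "s vTable = Node (enc_tab tb) z" "s vLiteral = enc_clause (l # ls)"
    "s vScope = enc_list enc_nat sc" "s vKey = enc_key ks"
    and l: "fst l < length tb" "fst l < n"
  shows "reaches literal_prog s (8 * n + 28) (\<lambda>s'. s' vLiteral = enc_clause ls \<and>
    s' vScope = enc_list enc_nat (fst (tb ! fst l) # sc) \<and>
    s' vKey = enc_key ((snd (tb ! fst l), snd l) # ks))"
proof -
  define s1 where "s1 = s(vPointer := enc_tab tb, vSteps := enc_nat (fst l))"
  have "reaches (drop_prog vPointer vSteps) s1 (8 * n + 2)
     (\<lambda>s'. s' vPointer = enc_tab (drop (fst l) tb) \<and> s' vLiteral = s vLiteral \<and> s' vScope = s vScope \<and> s' vKey = s vKey)"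
    by (rule reaches_mono[OF reaches_drop_prog])
      (use l in \<open>auto simp: s1_def writes_drop_prog funpow_right_enc_list\<close>)
  then have "reaches (Seq (drop_prog vPointer vSteps)
   (Seq (Assign vScope (ENode (ELeft (ELeft (EVar vPointer))) (EVar vScope)))
   (Seq (Assign vKey (ENode (ENode (ERight (ELeft (EVar vPointer))) (ERight (ELeft (EVar vLiteral)))) (EVar vKey)))
        (Assign vLiteral (ERight (EVar vLiteral)))))) s1 (8 * n + 2 + 19) (\<lambda>s'. s' vLiteral = enc_clause ls \<and>
    s' vScope = enc_list enc_nat (fst (tb ! fst l) # sc) \<and>
    s' vKey = enc_key ((snd (tb ! fst l), snd l) # ks))"
    using s l
    by (intro reaches_Seq[where T' = 19], elim reaches_mono)
      (auto intro!: reaches_Assign_Seq reaches_Assign simp: Cons_nth_drop_Suc[symmetric] enc_pair_eq)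
  moreover have "s1 = (s(vPointer := eval (ELeft (EVar vTable)) s))(vSteps := eval (ELeft (ELeft (EVar vLiteral))) (s(vPointer := eval (ELeft (EVar vTable)) s)))"
    by (simp add: s1_def s enc_pair_eq)
  ultimately show ?thesis unfolding literal_prog_def
    by (intro reaches_Assign_Seq[where T = "8 * n + 25" and T' = "8 * n + 28"]
        reaches_Assign_Seq[where T = "8 * n + 21" and T' = "8 * n + 25"]) (auto simp: add.commute)
qed

definition clause_prog :: prog where
  "clause_prog =
    Seq (Assign vLiteral (ELeft (EVar vClause)))
   (Seq (Assign vScope ELeaf)
   (Seq (Assign vKey ELeaf)
   (Seq (While (EVar vLiteral) literal_prog)
   (Seq lk
   (Seq (Assign vConstraints (ENode (ENode (EVar vScope) (EVar vRelation)) (EVar vConstraints)))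
        (Assign vClause (ERight (EVar vClause))))))))"

lemma writes_clause_prog [simp]: "writes clause_prog = {vPointer, vSteps, vScope, vKey, vLiteral, vRelation, vConstraints, vClause}"
  by (auto simp: clause_prog_def lk_writes)

lemma length_truth [simp]: "length (truth j k) = d"
  by (simp add: truth_def)

lemma length_snd_tab: "v < b * length js \<Longrightarrow> length (snd (tab js ! v)) = d"
  by (simp add: nth_tab)

lemma reaches_clause_prog:
  assumes s: "s vTable = Node (enc_tab (tab js)) z" "s vClause = enc_list enc_clause (c # cs)" "s vConstraints = enc_csp acc"
    and c: "length c \<le> 3" "\<And>l. l \<in> set c \<Longrightarrow> fst l < n" and n: "n \<le> b * length js"
  shows "reaches clause_prog s (24 * n + 108 + Tl)
    (\<lambda>s'. s' vClause = enc_list enc_clause cs \<and> s' vConstraints = enc_csp (constraint js c # acc))"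
proof -
  define s1 where "s1 = s(vLiteral := enc_clause c, vScope := Leaf, vKey := Leaf)"
  let ?g = "\<lambda>l. fst (tab js ! fst l)" and ?k = "\<lambda>l. (snd (tab js ! fst l), snd l)"
  have "reaches (While (EVar vLiteral) literal_prog) s1 (24 * n + 92)
      (\<lambda>s'. s' vScope = enc_list enc_nat (scope js c) \<and> s' vKey = enc_key (key js c)
          \<and> s' vClause = s vClause \<and> s' vConstraints = s vConstraints)"
  \<comment> \<open>The remaining literals, reversed, followed by the accumulators always give the
    final lists. The bound is \<open>3 * (8 * n + 30) + 2\<close>, for at most three
    literals.\<close>
  proof (rule reaches_While_list[where xs = c and T = "8 * n + 28" and I = "\<lambda>ls s'. set ls \<subseteq> set c \<and>
      s' vLiteral = enc_clause ls \<and> (\<exists>sc ks. s' vScope = enc_list enc_nat sc \<and> s' vKey = enc_key ks \<and>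
        rev (map ?g ls) @ sc = scope js c \<and> rev (map ?k ls) @ ks = key js c)"])
    show "set c \<subseteq> set c \<and> s1 vLiteral = enc_clause c \<and> (\<exists>sc ks. s1 vScope = enc_list enc_nat sc \<and> s1 vKey = enc_key ks \<and>
        rev (map ?g c) @ sc = scope js c \<and> rev (map ?k c) @ ks = key js c)"
      by (auto simp: s1_def scope_def key_def rev_map intro!: exI[of _ "[]"])
  next
    fix l ls s' assume I: "set (l # ls) \<subseteq> set c \<and> s' vLiteral = enc_clause (l # ls) \<and>
      (\<exists>sc ks. s' vScope = enc_list enc_nat sc \<and> s' vKey = enc_key ks \<and>
        rev (map ?g (l # ls)) @ sc = scope js c \<and> rev (map ?k (l # ls)) @ ks = key js c)"
      and fr: "\<And>v. v \<notin> writes literal_prog \<Longrightarrow> s' v = s1 v"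
    then obtain sc ks where sk: "s' vScope = enc_list enc_nat sc" "s' vKey = enc_key ks"
      "rev (map ?g ls) @ ?g l # sc = scope js c" "rev (map ?k ls) @ ?k l # ks = key js c" by auto
    have tab: "s' vTable = Node (enc_tab (tab js)) z" using fr[of vTable] s(1) by (simp add: s1_def)
    have l: "fst l < n" using I c(2) by simp
    have "reaches literal_prog s' (8 * n + 28) (\<lambda>s'. s' vLiteral = enc_clause ls \<and>
      s' vScope = enc_list enc_nat (?g l # sc) \<and> s' vKey = enc_key (?k l # ks))"
      by (rule reaches_literal_prog[OF tab _ sk(1,2)]) (use I l n in auto)
    then show "eval (EVar vLiteral) s' \<noteq> Leaf \<and> reaches literal_prog s' (8 * n + 28)
     (\<lambda>s'. set ls \<subseteq> set c \<and> s' vLiteral = enc_clause ls \<and> (\<exists>sc ks. s' vScope = enc_list enc_nat sc \<and> s' vKey = enc_key ks \<and>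
        rev (map ?g ls) @ sc = scope js c \<and> rev (map ?k ls) @ ks = key js c))"
      using I sk(3,4) by (auto elim!: reaches_mono simp del: enc_list.simps(2)) (simp)
  next
    have "length c * (1 + cost (EVar vLiteral) + (8 * n + 28)) \<le> 3 * (1 + cost (EVar vLiteral) + (8 * n + 28))"
      using c(1) by (rule mult_right_mono) simp
    then show "length c * (1 + cost (EVar vLiteral) + (8 * n + 28)) + 1 + cost (EVar vLiteral) \<le> 24 * n + 92" by simp
  qed (auto simp: s1_def)
  then have 1: "reaches (Seq (While (EVar vLiteral) literal_prog) (Seq lk
     (Seq (Assign vConstraints (ENode (ENode (EVar vScope) (EVar vRelation)) (EVar vConstraints))) (Assign vClause (ERight (EVar vClause)))))) s1
    (24 * n + 101 + Tl) (\<lambda>s'. s' vClause = enc_list enc_clause cs \<and> s' vConstraints = enc_csp (constraint js c # acc))"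
  proof (rule reaches_Seq[where T' = "Tl + 9", OF reaches_mono[OF _ order_refl]])
    fix s2 assume s2: "s2 vScope = enc_list enc_nat (scope js c) \<and> s2 vKey = enc_key (key js c) \<and> s2 vClause = s vClause \<and> s2 vConstraints = s vConstraints"
    have "reaches lk s2 Tl (\<lambda>s'. s' vRelation = enc_list (enc_list enc_nat) (rel (key js c)))"
    proof (rule lk_reaches)
      show "length (fst k) = d" if "k \<in> set (key js c)" for k
        using that length_snd_tab[OF order.strict_trans2[OF c(2) n]] by (auto simp: key_def)
    qed (use s2 c in \<open>auto simp: key_def\<close>)
    then show "reaches (Seq lk (Seq (Assign vConstraints (ENode (ENode (EVar vScope) (EVar vRelation)) (EVar vConstraints)))
       (Assign vClause (ERight (EVar vClause))))) s2 (Tl + 9)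
       (\<lambda>s'. s' vClause = enc_list enc_clause cs \<and> s' vConstraints = enc_csp (constraint js c # acc))"
      by (rule reaches_Seq[where T' = 9, OF reaches_mono[OF _ order_refl]])
       (use s2 s in \<open>auto intro!: reaches_Assign_Seq reaches_Assign simp: lk_writes constraint_def\<close>)
  qed simp
  show ?thesis unfolding clause_prog_def
    by (rule reaches_Assign_Seq[where T = "24 * n + 105 + Tl"],
        rule reaches_Assign_Seq[where T = "24 * n + 103 + Tl"],
        rule reaches_Assign_Seq[where T = "24 * n + 101 + Tl"])
      (use 1 s in \<open>simp_all add: s1_def\<close>)
qed

definition build_prog :: prog where
  "build_prog = Seq (Assign vConstraints ELeaf) (Seq (Assign vClause (EVar vClauses)) (While (EVar vClause) clause_prog))"

definition build_time :: "nat \<Rightarrow> nat \<Rightarrow> nat" where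
  "build_time M n = M * (24 * n + 110 + Tl) + 6"

lemma writes_build_prog [simp]: "writes build_prog = {vPointer, vSteps, vScope, vKey, vLiteral, vRelation, vConstraints, vClause}"
  by (auto simp: build_prog_def)

lemma reaches_build_prog:
  assumes s: "s vTable = Node (enc_tab (tab js)) z" "s vClauses = enc_list enc_clause cs"
    and cs: "valid n cs" "length cs \<le> M" and n: "n \<le> b * length js"
  shows "reaches build_prog s (build_time M n) (\<lambda>s'. s' vConstraints = enc_csp (rev (map (constraint js) cs)))"
proof -
  define s1 where "s1 = s(vConstraints := Leaf, vClause := enc_list enc_clause cs)"
  have loop: "reaches (While (EVar vClause) clause_prog) s1 (M * (24 * n + 110 + Tl) + 2)
      (\<lambda>s'. s' vConstraints = enc_csp (rev (map (constraint js) cs)))"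
  proof (rule reaches_While_list[where xs = cs and T = "24 * n + 108 + Tl" and I = "\<lambda>ds s'. set ds \<subseteq> set cs \<and>
      s' vClause = enc_list enc_clause ds \<and>
      (\<exists>acc. s' vConstraints = enc_csp acc \<and> rev (map (constraint js) ds) @ acc = rev (map (constraint js) cs))"])
    fix c ds s' assume I: "set (c # ds) \<subseteq> set cs \<and> s' vClause = enc_list enc_clause (c # ds) \<and>
      (\<exists>acc. s' vConstraints = enc_csp acc \<and> rev (map (constraint js) (c # ds)) @ acc = rev (map (constraint js) cs))"
      and fr: "\<And>v. v \<notin> writes clause_prog \<Longrightarrow> s' v = s1 v"
    then obtain acc where acc: "s' vConstraints = enc_csp acc"
       "rev (map (constraint js) ds) @ constraint js c # acc = rev (map (constraint js) cs)" by auto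
    have tab: "s' vTable = Node (enc_tab (tab js)) z" using fr[of vTable] s(1) by (simp add: s1_def)
    have "reaches clause_prog s' (24 * n + 108 + Tl)
      (\<lambda>s'. s' vClause = enc_list enc_clause ds \<and> s' vConstraints = enc_csp (constraint js c # acc))"
      by (rule reaches_clause_prog[OF tab _ acc(1) _ _ n]) (use I cs in \<open>auto simp: valid_def\<close>)
    then show "eval (EVar vClause) s' \<noteq> Leaf \<and> reaches clause_prog s' (24 * n + 108 + Tl)
      (\<lambda>s'. set ds \<subseteq> set cs \<and> s' vClause = enc_list enc_clause ds \<and>
      (\<exists>acc. s' vConstraints = enc_csp acc \<and> rev (map (constraint js) ds) @ acc = rev (map (constraint js) cs)))"
      using I acc(2) by (auto elim!: reaches_mono simp del: enc_list.simps(2)) simp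
  next
    have "length cs * (1 + cost (EVar vClause) + (24 * n + 108 + Tl)) \<le> M * (24 * n + 110 + Tl)"
      using cs(2) by (intro mult_le_mono) auto
    then show "length cs * (1 + cost (EVar vClause) + (24 * n + 108 + Tl)) + 1 + cost (EVar vClause) \<le> M * (24 * n + 110 + Tl) + 2"
      by simp
  qed (auto simp: s1_def intro!: exI[of _ "[]"])
  show ?thesis unfolding build_prog_def build_time_def
    by (rule reaches_Assign_Seq[where T = "M * (24 * n + 110 + Tl) + 4"],
        rule reaches_Assign_Seq[where T = "M * (24 * n + 110 + Tl) + 2"])
      (use loop s(2) in \<open>simp_all add: s1_def\<close>)
qed

text \<open>Dropping the new value from \<open>vBest\<close> leaves a nonempty tree iff the new
  value is smaller. The assignment to \<open>vSteps\<close> in the other case stands for doing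
  nothing.\<close>

definition branch_prog :: prog where
  "branch_prog =
    Seq build_prog
   (Seq (call_prog p V (ENode (EVar vGroups) (EVar vConstraints)))
   (Seq (Assign vPointer (EVar vBest))
   (Seq (Assign vSteps (EVar 0))
   (Seq (drop_prog vPointer vSteps)
   (Seq (Cond (EVar vPointer) (Assign vBest (EVar 0)) (Assign vSteps ELeaf))
        (Assign vTable (ERight (EVar vTable))))))))"

definition branch_time :: "nat \<Rightarrow> nat \<Rightarrow> nat \<Rightarrow> nat" where
  "branch_time M n N = build_time M n + Tp N + 2 * V + 8 * M + 30"

lemma writes_branch_prog [simp]:
  "writes branch_prog = {..V} \<union> {vPointer, vSteps, vScope, vKey, vLiteral, vRelation, vConstraints, vClause, vBest, vTable}"
  by (auto simp: branch_prog_def writes_call_prog[OF p_vars] writes_drop_prog)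

text \<open>Keeps the unary comparison of values linear in the number of clauses.\<close>

lemma max_csp_instance_of_le: "max_csp d N (instance_of js cs) \<le> length cs"
proof -
  have fin: "finite (instance_of js cs)" by (simp add: instance_of_def)
  have "max_csp d N (instance_of js cs) \<le> card (violated_by (instance_of js cs) (\<lambda>_. 1))"
    using d_ge_2 by (intro max_csp_le) auto
  also have "\<dots> \<le> card (instance_of js cs)"
    by (rule card_mono[OF fin]) (auto simp: violated_by_def)
  also have "\<dots> \<le> card (set (map (constraint js) cs))"
    unfolding instance_of_def by (rule card_image_le) simp
  also have "\<dots> \<le> length cs" using card_length[of "map (constraint js) cs"] by simp
  finally show ?thesis .
qed

lemma reaches_branch_prog:
  assumes s: "s vTable = Node (enc_tab (tab js)) z" "s vClauses = enc_list enc_clause cs" "s vGroups = enc_nat (length js)"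
    and cs: "valid n cs" "length cs \<le> M" and n: "n \<le> b * length js"
  shows "reaches branch_prog s (branch_time M n (length js)) (\<lambda>s'. s' vTable = z \<and>
    spine (s' vBest) = min (max_csp d (length js) (instance_of js cs)) (spine (s vBest)))"
proof -
  let ?v = "max_csp d (length js) (instance_of js cs)"
  let ?Q = "\<lambda>s'. s' vTable = z \<and> spine (s' vBest) = min ?v (spine (s vBest))"
  obtain t where t: "t \<le> Tp (length js)" "runs p (Node (enc_nat (length js)) (enc_csp (rev (map (constraint js) cs)))) t (enc_nat ?v)"
    using p_solves[OF csp_instance_instance_of[OF cs(1) n] csp_input_instance_of[OF cs(1) n]] by blast
  have v: "?v \<le> M" using max_csp_instance_of_le cs(2) le_trans by blast
  have fin: "reaches (Seq (Cond (EVar vPointer) (Assign vBest (EVar 0)) (Assign vSteps ELeaf)) (Assign vTable (ERight (EVar vTable)))) s' 7 ?Q"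
    if s': "s' 0 = enc_nat ?v" "s' vTable = s vTable" "s' vBest = s vBest" "s' vPointer = (right ^^ ?v) (s vBest)" for s'
  proof (rule reaches_Seq[where T = 4 and T' = 3])
    have vPointer: "s' vPointer = Leaf \<longleftrightarrow> spine (s vBest) \<le> ?v"
      by (simp add: s' spine_funpow_right flip: spine_eq_0_iff)
    show "reaches (Cond (EVar vPointer) (Assign vBest (EVar 0)) (Assign vSteps ELeaf)) s' 4
      (\<lambda>s'. reaches (Assign vTable (ERight (EVar vTable))) s' 3 ?Q)"
      by (rule reaches_Cond[where T = 2]) (use s s' vPointer in \<open>auto intro!: reaches_Assign\<close>)
  qed simp
  have drop: "reaches (Seq (drop_prog vPointer vSteps) (Seq (Cond (EVar vPointer) (Assign vBest (EVar 0)) (Assign vSteps ELeaf)) (Assign vTable (ERight (EVar vTable)))))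
      s' (8 * M + 9) ?Q"
    if s': "s' 0 = enc_nat ?v" "s' vTable = s vTable" "s' vBest = s vBest" "s' vPointer = s vBest" "s' vSteps = enc_nat ?v" for s'
    by (rule reaches_Seq[where T = "8 * M + 2" and T' = 7, OF reaches_mono[OF reaches_drop_prog]])
      (use s' v in \<open>auto intro!: fin simp: writes_drop_prog\<close>)
  show ?thesis unfolding branch_prog_def
  proof (rule reaches_Seq[where T' = "Tp (length js) + 2 * V + 8 * M + 24",
        OF reaches_mono[OF reaches_build_prog[OF s(1,2) cs n] order_refl]])
    fix s1 assume s1: "s1 vConstraints = enc_csp (rev (map (constraint js) cs))"
      "\<And>v. v \<notin> writes build_prog \<Longrightarrow> s1 v = s v"
    have run: "runs p (eval (ENode (EVar vGroups) (EVar vConstraints)) s1) t (enc_nat ?v)"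
      using t(2) s1(1) s1(2)[of vGroups] s(3) by simp
    show "reaches (Seq (call_prog p V (ENode (EVar vGroups) (EVar vConstraints)))
       (Seq (Assign vPointer (EVar vBest)) (Seq (Assign vSteps (EVar 0)) (Seq (drop_prog vPointer vSteps)
       (Seq (Cond (EVar vPointer) (Assign vBest (EVar 0)) (Assign vSteps ELeaf)) (Assign vTable (ERight (EVar vTable)))))))) s1
       (Tp (length js) + 2 * V + 8 * M + 24) ?Q"
    proof (rule reaches_Seq[where T = "2 * V + 6 + Tp (length js)" and T' = "8 * M + 13",
          OF reaches_mono[OF reaches_call_prog[OF p_vars _ run order_refl]]])
      fix s2 assume s2: "s2 0 = enc_nat ?v"
         "\<And>v. v \<notin> writes (call_prog p V (ENode (EVar vGroups) (EVar vConstraints))) \<Longrightarrow> s2 v = s1 v"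
      have fr: "s2 vBest = s vBest" "s2 vTable = s vTable"
        using s1(2)[of vBest] s2(2)[of vBest] s1(2)[of vTable] s2(2)[of vTable] by (auto simp: writes_call_prog[OF p_vars])
      show "reaches (Seq (Assign vPointer (EVar vBest)) (Seq (Assign vSteps (EVar 0)) (Seq (drop_prog vPointer vSteps)
       (Seq (Cond (EVar vPointer) (Assign vBest (EVar 0)) (Assign vSteps ELeaf)) (Assign vTable (ERight (EVar vTable))))))) s2
       (8 * M + 13) ?Q"
        by (rule reaches_Assign_Seq[where T = "8 * M + 11"], rule reaches_Assign_Seq[where T = "8 * M + 9"], rule drop)
          (use s2(1) fr in auto)
    qed (use t(1) in auto)
  qed (simp add: branch_time_def)
qed

text \<open>
  Only the lengths of the right spines of results are compared, so the list of clauses itself can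
  serve as the initial upper bound on the optimum.
\<close>

definition opt_prog :: prog where
  "opt_prog = Seq (Assign vBest (EVar vClauses)) (Seq (Assign vTable (EVar vTables)) (While (EVar vTable) branch_prog))"

definition opt_time :: "nat \<Rightarrow> nat \<Rightarrow> nat \<Rightarrow> nat" where
  "opt_time M n t = length covs ^ t * (2 + branch_time M n (t * q)) + 6"

lemma writes_opt_prog [simp]:
  "writes opt_prog = {..V} \<union> {vPointer, vSteps, vScope, vKey, vLiteral, vRelation, vConstraints, vClause, vBest, vTable}"
  by (auto simp: opt_prog_def)

lemma reaches_opt_prog:
  assumes s: "s vTables = enc_list (\<lambda>js. enc_tab (tab js)) (branches covs t)"
    "s vClauses = enc_list enc_clause cs" "s vGroups = enc_nat (t * q)"
    and cs: "valid n cs" "length cs \<le> M" and n: "n \<le> b * (t * q)"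
  shows "reaches opt_prog s (opt_time M n t) (\<lambda>s'. spine (s' vBest) = min_violated cs)"
proof -
  define s1 where "s1 = s(vBest := s vClauses, vTable := s vTables)"
  let ?v = "\<lambda>js. max_csp d (t * q) (instance_of js cs)"
  have loop: "reaches (While (EVar vTable) branch_prog) s1 (length covs ^ t * (2 + branch_time M n (t * q)) + 2)
      (\<lambda>s'. spine (s' vBest) = min_violated cs)"
  proof (rule reaches_While_list[where xs = "branches covs t" and T = "branch_time M n (t * q)" and
      I = "\<lambda>bs s'. set bs \<subseteq> set (branches covs t) \<and> s' vTable = enc_list (\<lambda>js. enc_tab (tab js)) bs \<and>
        fold min (map ?v bs) (spine (s' vBest)) = min_violated cs"])
    show "set (branches covs t) \<subseteq> set (branches covs t) \<and>
        s1 vTable = enc_list (\<lambda>js. enc_tab (tab js)) (branches covs t) \<and>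
        fold min (map ?v (branches covs t)) (spine (s1 vBest)) = min_violated cs"
      using min_violated_eq[OF covs_length covs_cover cs(1) n] s by (simp add: s1_def)
  next
    fix js bs s' assume I: "set (js # bs) \<subseteq> set (branches covs t) \<and>
        s' vTable = enc_list (\<lambda>js. enc_tab (tab js)) (js # bs) \<and>
        fold min (map ?v (js # bs)) (spine (s' vBest)) = min_violated cs"
      and fr: "\<And>v. v \<notin> writes branch_prog \<Longrightarrow> s' v = s1 v"
    then have len: "length js = t * q" using length_of_branch[OF _ covs_length] by auto
    have fr': "s' vClauses = s vClauses" "s' vGroups = s vGroups" using fr[of vClauses] fr[of vGroups] by (auto simp: s1_def)
    have "reaches branch_prog s' (branch_time M n (length js)) (\<lambda>s2.
        s2 vTable = enc_list (\<lambda>js. enc_tab (tab js)) bs \<and>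
        spine (s2 vBest) = min (max_csp d (length js) (instance_of js cs)) (spine (s' vBest)))"
      by (rule reaches_branch_prog[OF _ _ _ cs]) (use I fr' s n len in auto)
    then show "eval (EVar vTable) s' \<noteq> Leaf \<and> reaches branch_prog s' (branch_time M n (t * q))
      (\<lambda>s'. set bs \<subseteq> set (branches covs t) \<and> s' vTable = enc_list (\<lambda>js. enc_tab (tab js)) bs \<and>
        fold min (map ?v bs) (spine (s' vBest)) = min_violated cs)"
      using I len by (auto elim!: reaches_mono)
  qed (auto simp: length_branches)
  show ?thesis unfolding opt_prog_def opt_time_def
    by (rule reaches_Assign_Seq[where T = "length covs ^ t * (2 + branch_time M n (t * q)) + 4"],
        rule reaches_Assign_Seq[where T = "length covs ^ t * (2 + branch_time M n (t * q)) + 2"])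
      (use loop in \<open>simp_all add: s1_def\<close>)
qed


section \<open>Generating the tables of all branches\<close>

lemma covs_nonempty: "length covs \<ge> 1"
proof -
  \<comment> \<open>Already the zero vector must be covered. Nonemptiness makes the powers of
    \<open>length covs\<close> monotone, on which the time bounds rely.\<close>
  have "\<exists>c \<in> set covs. list_all2 (in_row (2 ^ b) d) (replicate q 0) c"
    by (rule covs_cover) auto
  then show ?thesis by (cases covs) auto
qed

text \<open>The truth tables of a covering vector are constants of the program, so extending a table
  costs constant time. Only the group numbers depend on the branch; they are offsets from its
  current length in \<open>vGroups\<close>.\<close>

fun extend_expr :: "nat list \<Rightarrow> expr" where
  "extend_expr [] = ELeft (EVar vTable)"
| "extend_expr (j # c) = foldr (\<lambda>k e. ENode
     (ENode ((ENode ELeaf ^^ length c) (EVar vGroups)) (const_expr (enc_list enc_bool (truth j k)))) e)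
     [0..<b] (extend_expr c)"

lemma eval_succ_expr: "eval ((ENode ELeaf ^^ k) e) s = (Node Leaf ^^ k) (eval e s)"
  by (induction k) auto

lemma Node_Leaf_funpow: "(Node Leaf ^^ k) (enc_nat n) = enc_nat (k + n)"
  by (induction k) auto

lemma eval_foldr_ENode:
  "eval (foldr (\<lambda>x. ENode (f x)) xs e) s = foldr (\<lambda>x. Node (eval (f x) s)) xs (eval e s)"
  by (induction xs) auto

lemma foldr_Node_enc_list:
  "(\<And>x. x \<in> set xs \<Longrightarrow> g x = f (h x)) \<Longrightarrow>
    foldr (\<lambda>x. Node (g x)) xs (enc_list f ys) = enc_list f (map h xs @ ys)"
  by (induction xs) auto

lemma eval_extend_expr:
  assumes "s vTable = Node (enc_tab (tab js)) z" "s vGroups = enc_nat (length js)"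
  shows "eval (extend_expr c) s = enc_tab (tab (c @ js))"
proof (induction c)
  case (Cons j c)
  have "eval (extend_expr (j # c)) s = foldr (\<lambda>k. Node (Node (enc_nat (length c + length js))
      (enc_list enc_bool (truth j k)))) [0..<b] (enc_tab (tab (c @ js)))"
    by (simp add: eval_foldr_ENode Cons eval_succ_expr Node_Leaf_funpow assms)
  also have "\<dots> = enc_tab (map (\<lambda>k. (length c + length js, truth j k)) [0..<b] @ tab (c @ js))"
    by (rule foldr_Node_enc_list) simp
  finally show ?case by simp
qed (simp add: assms)

definition new_expr :: expr where
  "new_expr = foldr (\<lambda>c. ENode (extend_expr c)) covs (EVar vNew)"

lemma eval_new_expr:
  assumes "s vTable = Node (enc_tab (tab js)) z" "s vGroups = enc_nat (length js)"
    "s vNew = enc_list (\<lambda>js. enc_tab (tab js)) acc"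
  shows "eval new_expr s = enc_list (\<lambda>js. enc_tab (tab js)) (map (\<lambda>c. c @ js) covs @ acc)"
  unfolding new_expr_def eval_foldr_ENode eval.simps assms(3)
  by (rule foldr_Node_enc_list) (rule eval_extend_expr[OF assms(1,2)])

lemma eval_pred_expr: "eval ((ERight ^^ k) e) s = (right ^^ k) (eval e s)"
  by (induction k) auto

text \<open>\<open>right Leaf = Leaf\<close> makes the counter saturate at zero, so a last block
  that is only partly filled needs no special case.\<close>

definition block_prog :: prog where
  "block_prog =
    Seq (Assign vCounter ((ERight ^^ (b * q)) (EVar vCounter)))
   (Seq (Assign vNew ELeaf)
   (Seq (Assign vTable (EVar vTables))
   (Seq (While (EVar vTable) (Seq (Assign vNew new_expr) (Assign vTable (ERight (EVar vTable)))))
   (Seq (Assign vTables (EVar vNew))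
        (Assign vGroups ((ENode ELeaf ^^ q) (EVar vGroups)))))))"

definition block_const :: nat where
  "block_const = cost ((ERight ^^ (b * q)) (EVar vCounter)) + cost ((ENode ELeaf ^^ q) (EVar vGroups)) + 10"

lemma writes_block_prog [simp]: "writes block_prog = {vCounter, vNew, vTable, vTables, vGroups}"
  by (auto simp: block_prog_def)

text \<open>The rule for loops wants one bound for all rounds, so the time is stated with the final
  level \<open>u\<close> instead of \<open>t\<close>.\<close>

lemma reaches_block_prog:
  assumes s: "s vCounter = enc_nat k" "s vTables = enc_list (\<lambda>js. enc_tab (tab js)) (branches covs t)"
    "s vGroups = enc_nat (t * q)" and t: "t \<le> u"
  shows "reaches block_prog s (length covs ^ u * (cost new_expr + 6) + block_const)
    (\<lambda>s'. s' vCounter = enc_nat (k - b * q) \<and>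
       s' vTables = enc_list (\<lambda>js. enc_tab (tab js)) (branches covs (Suc t)) \<and>
       s' vGroups = enc_nat (Suc t * q))"
proof -
  let ?e = "enc_list (\<lambda>js. enc_tab (tab js))"
  let ?T = "length covs ^ u * (cost new_expr + 6)"
  let ?Q = "\<lambda>s'. s' vCounter = enc_nat (k - b * q) \<and> s' vTables = ?e (branches covs (Suc t)) \<and> s' vGroups = enc_nat (Suc t * q)"
  define s1 where "s1 = s(vCounter := enc_nat (k - b * q), vNew := Leaf, vTable := s vTables)"
  have loop: "reaches (While (EVar vTable) (Seq (Assign vNew new_expr) (Assign vTable (ERight (EVar vTable))))) s1 (?T + 2)
     (\<lambda>s'. s' vNew = ?e (branches covs (Suc t)) \<and> s' vCounter = s1 vCounter \<and> s' vGroups = s1 vGroups)"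
  proof (rule reaches_While_list[where xs = "branches covs t" and T = "cost new_expr + 4" and
      I = "\<lambda>bs s'. set bs \<subseteq> set (branches covs t) \<and> s' vTable = ?e bs \<and> (\<exists>acc. s' vNew = ?e acc \<and>
        fold (\<lambda>js acc. map (\<lambda>c. c @ js) covs @ acc) bs acc = branches covs (Suc t))"])
    fix js bs s' assume I: "set (js # bs) \<subseteq> set (branches covs t) \<and> s' vTable = ?e (js # bs) \<and>
       (\<exists>acc. s' vNew = ?e acc \<and>
        fold (\<lambda>js acc. map (\<lambda>c. c @ js) covs @ acc) (js # bs) acc = branches covs (Suc t))"
      and fr: "\<And>v. v \<notin> writes (Seq (Assign vNew new_expr) (Assign vTable (ERight (EVar vTable)))) \<Longrightarrow> s' v = s1 v"
    then obtain acc where acc: "s' vNew = ?e acc"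
      "fold (\<lambda>js acc. map (\<lambda>c. c @ js) covs @ acc) bs (map (\<lambda>c. c @ js) covs @ acc) = branches covs (Suc t)"
      by auto
    have "length js = t * q" using I length_of_branch[OF _ covs_length] by auto
    then have "s' vGroups = enc_nat (length js)" using fr[of vGroups] s(3) by (simp add: s1_def)
    then have "eval new_expr s' = ?e (map (\<lambda>c. c @ js) covs @ acc)"
      using I acc(1) by (intro eval_new_expr) auto
    then show "eval (EVar vTable) s' \<noteq> Leaf \<and> reaches (Seq (Assign vNew new_expr) (Assign vTable (ERight (EVar vTable)))) s'
       (cost new_expr + 4) (\<lambda>s'. set bs \<subseteq> set (branches covs t) \<and> s' vTable = ?e bs \<and> (\<exists>acc. s' vNew = ?e acc \<and>
        fold (\<lambda>js acc. map (\<lambda>c. c @ js) covs @ acc) bs acc = branches covs (Suc t)))"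
      using I acc(2)
      by (auto intro!: reaches_Assign_Seq[where T = 3] reaches_Assign
          exI[of _ "map (\<lambda>c. c @ js) covs @ acc"])
  next
    have "length (branches covs t) \<le> length covs ^ u"
      using t covs_nonempty by (simp add: length_branches power_increasing)
    then have "length (branches covs t) * (1 + cost (EVar vTable) + (cost new_expr + 4)) \<le> ?T"
      by (intro mult_le_mono) auto
    then show "length (branches covs t) * (1 + cost (EVar vTable) + (cost new_expr + 4)) + 1 + cost (EVar vTable) \<le> ?T + 2"
      by simp
  qed (use s in \<open>auto simp: s1_def intro!: exI[of _ "[]"]\<close>)
  have rest: "reaches (Seq (While (EVar vTable) (Seq (Assign vNew new_expr) (Assign vTable (ERight (EVar vTable)))))
     (Seq (Assign vTables (EVar vNew)) (Assign vGroups ((ENode ELeaf ^^ q) (EVar vGroups))))) s1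
     (?T + 5 + cost ((ENode ELeaf ^^ q) (EVar vGroups))) ?Q"
    by (rule reaches_Seq[where T' = "3 + cost ((ENode ELeaf ^^ q) (EVar vGroups))", OF reaches_mono[OF loop order_refl]])
      (auto intro!: reaches_Assign_Seq[where T = "1 + cost ((ENode ELeaf ^^ q) (EVar vGroups))"] reaches_Assign
        simp: s1_def s eval_succ_expr Node_Leaf_funpow simp del: branches.simps)
  show ?thesis unfolding block_prog_def
    by (rule reaches_Assign_Seq[where T = "?T + 9 + cost ((ENode ELeaf ^^ q) (EVar vGroups))"],
        rule reaches_Assign_Seq[where T = "?T + 7 + cost ((ENode ELeaf ^^ q) (EVar vGroups))"],
        rule reaches_Assign_Seq[where T = "?T + 5 + cost ((ENode ELeaf ^^ q) (EVar vGroups))"])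
      (use rest s in \<open>simp_all add: s1_def eval_pred_expr funpow_right_enc_nat block_const_def\<close>)
qed

text \<open>The ceiling of \<open>n / (b * q)\<close>; the surplus bits of the last block belong to
  no variable of the formula.\<close>

definition num_blocks :: "nat \<Rightarrow> nat" where
  "num_blocks n = (n + b * q - 1) div (b * q)"

lemma bq_pos: "b * q > 0"
  using b_pos q_pos by simp

lemma num_blocks_ge: "n \<le> b * (num_blocks n * q)"
proof -
  have "n + b * q - 1 < b * q + b * q * num_blocks n"
    unfolding num_blocks_def by (rule dividend_less_times_div[OF bq_pos])
  moreover have "b * (num_blocks n * q) = b * q * num_blocks n" by simp
  ultimately show ?thesis by linarith
qed

text \<open>Fewer blocks leave some Boolean variable over, so the loop counter is still
  nonempty.\<close>

lemma num_blocks_minimal: "t < num_blocks n \<Longrightarrow> t * (b * q) < n"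
proof -
  assume "t < num_blocks n"
  then have "Suc t * (b * q) \<le> num_blocks n * (b * q)" by (intro mult_le_mono1) simp
  also have "\<dots> \<le> n + b * q - 1" unfolding num_blocks_def by simp
  finally show ?thesis using bq_pos unfolding mult_Suc by linarith
qed

text \<open>\<open>Node Leaf Leaf\<close> is the list whose only entry is the empty table, that is,
  \<open>branches covs 0\<close>.\<close>

definition init_prog :: prog where
  "init_prog = Seq (Assign vCounter (EVar vNum)) (Seq (Assign vGroups ELeaf) (Seq (Assign vTables (ENode ELeaf ELeaf))
     (While (EVar vCounter) block_prog)))"

definition init_time :: "nat \<Rightarrow> nat" where
  "init_time n = num_blocks n * (2 + (length covs ^ num_blocks n * (cost new_expr + 6) + block_const)) + 10"

lemma writes_init_prog [simp]: "writes init_prog = {vCounter, vNew, vTable, vTables, vGroups}"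
  by (auto simp: init_prog_def)

lemma reaches_init_prog:
  assumes s: "s vNum = enc_nat n"
  shows "reaches init_prog s (init_time n) (\<lambda>s'.
    s' vTables = enc_list (\<lambda>js. enc_tab (tab js)) (branches covs (num_blocks n)) \<and>
    s' vGroups = enc_nat (num_blocks n * q))"
proof -
  let ?e = "enc_list (\<lambda>js. enc_tab (tab js))"
  define u where "u = num_blocks n"
  let ?T = "length covs ^ u * (cost new_expr + 6) + block_const"
  define s1 where "s1 = s(vCounter := enc_nat n, vGroups := Leaf, vTables := Node Leaf Leaf)"
  have loop: "reaches (While (EVar vCounter) block_prog) s1 (u * (2 + ?T) + 2)
    (\<lambda>s'. s' vTables = ?e (branches covs u) \<and> s' vGroups = enc_nat (u * q))"
  proof (rule reaches_While_count[where k = u and T = ?T and I = "\<lambda>k s'. k \<le> u \<and>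
     s' vCounter = enc_nat (n - (u - k) * (b * q)) \<and> s' vTables = ?e (branches covs (u - k)) \<and> s' vGroups = enc_nat ((u - k) * q)"])
    fix k s' assume I: "Suc k \<le> u \<and> s' vCounter = enc_nat (n - (u - Suc k) * (b * q)) \<and>
       s' vTables = ?e (branches covs (u - Suc k)) \<and> s' vGroups = enc_nat ((u - Suc k) * q)"
    then have "(u - Suc k) * (b * q) < n" by (intro num_blocks_minimal) (simp add: u_def)
    then have "eval (EVar vCounter) s' \<noteq> Leaf" using I by (auto simp flip: spine_eq_0_iff)
    moreover have k: "Suc (u - Suc k) = u - k" using conjunct1[OF I] by arith
    moreover have "n - (u - Suc k) * (b * q) - b * q = n - (u - k) * (b * q)"
      by (simp flip: k)
    ultimately show "eval (EVar vCounter) s' \<noteq> Leaf \<and> reaches block_prog s' ?T (\<lambda>s'. k \<le> u \<and>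
     s' vCounter = enc_nat (n - (u - k) * (b * q)) \<and> s' vTables = ?e (branches covs (u - k)) \<and> s' vGroups = enc_nat ((u - k) * q))"
      using I reaches_block_prog[of s' "n - (u - Suc k) * (b * q)" "u - Suc k" u]
      by (auto elim!: reaches_mono simp del: branches.simps)
  next
    fix s' assume "0 \<le> u \<and> s' vCounter = enc_nat (n - (u - 0) * (b * q)) \<and>
       s' vTables = ?e (branches covs (u - 0)) \<and> s' vGroups = enc_nat ((u - 0) * q)"
    moreover have "n - u * (b * q) = 0" using num_blocks_ge[of n] by (simp add: u_def algebra_simps)
    ultimately show "eval (EVar vCounter) s' = Leaf \<and> s' vTables = ?e (branches covs u) \<and> s' vGroups = enc_nat (u * q)"
      by simp
  qed (auto simp: s1_def)
  show ?thesis unfolding init_prog_def init_time_def u_def[symmetric]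
    by (rule reaches_Assign_Seq[where T = "u * (2 + ?T) + 8"],
        rule reaches_Assign_Seq[where T = "u * (2 + ?T) + 6"],
        rule reaches_Assign_Seq[where T = "u * (2 + ?T) + 2"])
      (use loop s in \<open>simp_all add: s1_def\<close>)
qed

section \<open>Self-reduction from optimal values to an optimal assignment\<close>

definition double_unit_expr :: "bool \<Rightarrow> expr" where
  "double_unit_expr x = (let l = ENode (EVar vCounter) (const_expr (enc_bool x)) in ENode l (ENode l ELeaf))"

lemma eval_double_unit_expr: "s vCounter = enc_nat v \<Longrightarrow> eval (double_unit_expr x) s = enc_clause [(v, x), (v, x)]"
  by (simp add: double_unit_expr_def Let_def)

lemma cost_double_unit_expr: "cost (double_unit_expr x) \<le> 13"
  by (cases x) (simp_all add: double_unit_expr_def Let_def)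

text \<open>Only the value True is tried: if it raises the optimum, False must be right, and the
  clause just added is exchanged. Variables are fixed from the last to the first, so consing yields
  the output in the right order.\<close>

definition fix_prog :: prog where
  "fix_prog =
    Seq (Assign vCounter (ERight (EVar vCounter)))
   (Seq (Assign vClauses (ENode (double_unit_expr True) (EVar vClauses)))
   (Seq opt_prog
   (Seq (Assign vPointer (EVar vBest))
   (Seq (Assign vSteps (EVar vTarget))
   (Seq (drop_prog vPointer vSteps)
        (Cond (EVar vPointer)
          (Seq (Assign vOutput (ENode (const_expr (enc_bool False)) (EVar vOutput)))
               (Assign vClauses (ENode (double_unit_expr False) (ERight (EVar vClauses)))))
          (Assign vOutput (ENode (const_expr (enc_bool True)) (EVar vOutput)))))))))"

definition fix_time :: "nat \<Rightarrow> nat \<Rightarrow> nat" where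
  "fix_time M n = opt_time M n (num_blocks n) + 8 * M + 60"

lemma writes_fix_prog [simp]:
  "writes fix_prog = {..V} \<union> {vCounter, vClauses, vOutput, vPointer, vSteps, vScope, vKey, vLiteral, vRelation, vConstraints, vClause, vBest, vTable}"
  by (auto simp: fix_prog_def writes_drop_prog)

lemma reaches_fix_prog:
  assumes s: "s vCounter = enc_nat (Suc v)" "s vClauses = enc_list enc_clause cs" "s vOutput = out" "spine (s vTarget) = m"
    "s vTables = enc_list (\<lambda>js. enc_tab (tab js)) (branches covs (num_blocks n))"
    "s vGroups = enc_nat (num_blocks n * q)"
    and cs: "valid n ([(v, True), (v, True)] # cs)" "length cs < M" "m \<le> M"
    and x: "x \<longleftrightarrow> min_violated ([(v, True), (v, True)] # cs) \<le> m"
  shows "reaches fix_prog s (fix_time M n) (\<lambda>s'. s' vCounter = enc_nat v \<and>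
     s' vClauses = enc_list enc_clause ([(v, x), (v, x)] # cs) \<and> s' vOutput = Node (enc_bool x) out)"
proof -
  let ?c = "\<lambda>x. [(v, x), (v, x)]"
  let ?Q = "\<lambda>s'. s' vCounter = enc_nat v \<and>
     s' vClauses = enc_list enc_clause (?c x # cs) \<and> s' vOutput = Node (enc_bool x) out"
  let ?cond = "Cond (EVar vPointer)
          (Seq (Assign vOutput (ENode (const_expr (enc_bool False)) (EVar vOutput)))
               (Assign vClauses (ENode (double_unit_expr False) (ERight (EVar vClauses)))))
          (Assign vOutput (ENode (const_expr (enc_bool True)) (EVar vOutput)))"
  define s1 where "s1 = s(vCounter := enc_nat v, vClauses := enc_list enc_clause (?c True # cs))"
  have cond: "reaches ?cond s' 30 ?Q"
    if s': "s' vCounter = enc_nat v" "s' vClauses = enc_list enc_clause (?c True # cs)" "s' vOutput = out"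
      "s' vPointer = Leaf \<longleftrightarrow> x" for s'
  proof (rule reaches_Cond[where T = 24])
    assume "eval (EVar vPointer) s' \<noteq> Leaf"
    then have x: "x = False" using s'(4) by simp
    show "reaches (Seq (Assign vOutput (ENode (const_expr (enc_bool False)) (EVar vOutput)))
               (Assign vClauses (ENode (double_unit_expr False) (ERight (EVar vClauses))))) s' 24 ?Q"
      by (rule reaches_Assign_Seq[where T = 20], rule reaches_Assign)
        (use x s'(1-3) cost_double_unit_expr[of False] in \<open>simp_all add: eval_double_unit_expr[where v = v]\<close>)
  next
    assume "eval (EVar vPointer) s' = Leaf"
    then have x: "x = True" using s'(4) by simp
    show "reaches (Assign vOutput (ENode (const_expr (enc_bool True)) (EVar vOutput))) s' 24 ?Q"
      by (rule reaches_Assign) (use x s'(1-3) in simp_all)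
  qed simp
  have drop: "reaches (Seq (drop_prog vPointer vSteps) ?cond) s' (8 * M + 32) ?Q"
    if s': "s' vCounter = enc_nat v" "s' vClauses = enc_list enc_clause (?c True # cs)" "s' vOutput = out"
      "spine (s' vPointer) = min_violated (?c True # cs)" "spine (s' vSteps) = m" for s'
  proof (rule reaches_Seq[where T = "8 * M + 2" and T' = 30, OF reaches_mono[OF reaches_drop_prog]])
    fix s2 assume s2: "s2 vPointer = (right ^^ spine (s' vSteps)) (s' vPointer)"
      "\<And>v. v \<notin> writes (drop_prog vPointer vSteps) \<Longrightarrow> s2 v = s' v"
    have "s2 vPointer = Leaf \<longleftrightarrow> x"
      using s'(4,5) x spine_eq_0_iff[of "s2 vPointer"] by (simp add: s2(1) spine_funpow_right)
    then show "reaches ?cond s2 30 ?Q"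
      using s'(1-3) s2(2)[of vCounter] s2(2)[of vClauses] s2(2)[of vOutput] by (intro cond) (simp_all add: writes_drop_prog)
  qed (use s'(5) cs(3) in simp_all)
  have opt: "reaches (Seq opt_prog (Seq (Assign vPointer (EVar vBest)) (Seq (Assign vSteps (EVar vTarget))
     (Seq (drop_prog vPointer vSteps) ?cond)))) s1 (opt_time M n (num_blocks n) + 8 * M + 36) ?Q"
  proof (rule reaches_Seq[where T = "opt_time M n (num_blocks n)" and T' = "8 * M + 36", OF reaches_mono[OF _ order_refl]])
    show "reaches opt_prog s1 (opt_time M n (num_blocks n)) (\<lambda>s'. spine (s' vBest) = min_violated (?c True # cs))"
      by (rule reaches_opt_prog[OF _ _ _ cs(1) _ num_blocks_ge]) (use s cs(2) in \<open>simp_all add: s1_def\<close>)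
    fix s' assume s': "spine (s' vBest) = min_violated (?c True # cs)"
      "\<And>v. v \<notin> writes opt_prog \<Longrightarrow> s' v = s1 v"
    show "reaches (Seq (Assign vPointer (EVar vBest)) (Seq (Assign vSteps (EVar vTarget))
     (Seq (drop_prog vPointer vSteps) ?cond))) s' (8 * M + 36) ?Q"
      by (rule reaches_Assign_Seq[where T = "8 * M + 34"], rule reaches_Assign_Seq[where T = "8 * M + 32"],
          rule drop)
        (use s s' in \<open>simp_all add: s1_def\<close>)
  qed simp
  show ?thesis unfolding fix_prog_def fix_time_def
    by (rule reaches_Assign_Seq[where T = "opt_time M n (num_blocks n) + 8 * M + 56"],
        rule reaches_Assign_Seq[where T = "opt_time M n (num_blocks n) + 8 * M + 36"])
     (use opt s(1,2) cost_double_unit_expr[of True] in \<open>simp_all add: s1_def eval_double_unit_expr[where v = v]\<close>)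
qed

definition solver :: prog where
  "solver =
    Seq (Assign vNum (ELeft (EVar 0)))
   (Seq (Assign vClauses (ERight (EVar 0)))
   (Seq init_prog
   (Seq opt_prog
   (Seq (Assign vTarget (EVar vBest))
   (Seq (Assign vOutput ELeaf)
   (Seq (Assign vCounter (EVar vNum))
   (Seq (While (EVar vCounter) fix_prog)
        (Assign 0 (EVar vOutput)))))))))"

definition solver_time :: "nat \<Rightarrow> nat \<Rightarrow> nat" where
  "solver_time m n = init_time n + opt_time m n (num_blocks n) + n * (2 + fix_time (m + n) n) + 20"

lemma valid_fixing:
  assumes "valid n cs" "\<And>c. c \<in> set cs \<Longrightarrow> distinct c" "k < n"
  shows "valid n ([(k, True), (k, True)] # fixing \<beta> [Suc k..<n] @ cs)"
proof -
  have "inj_on (\<lambda>v. [(v, \<beta> v), (v, \<beta> v)]) S" for S by (auto simp: inj_on_def)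
  moreover have "[(v, x), (v, x)] \<notin> set cs" for v x using assms(2) by fastforce
  ultimately show ?thesis using assms(1,3)
    by (auto simp: valid_def fixing_def distinct_map)
qed

lemma reaches_solver:
  assumes cs: "valid n cs" "\<And>c. c \<in> set cs \<Longrightarrow> distinct c"
    and s: "s 0 = Node (enc_nat n) (enc_list enc_clause cs)"
  shows "reaches solver s (solver_time (length cs) n) (\<lambda>s'. \<exists>\<beta>.
    s' 0 = enc_list enc_bool (map \<beta> [0..<n]) \<and> num_violated cs \<beta> = min_violated cs)"
proof -
  let ?e = "enc_list (\<lambda>js. enc_tab (tab js))"
  let ?m = "length cs" and ?u = "num_blocks n"
  let ?Q = "\<lambda>s'. \<exists>\<beta>. s' 0 = enc_list enc_bool (map \<beta> [0..<n]) \<and> num_violated cs \<beta> = min_violated cs"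
  let ?F = "n * (2 + fix_time (?m + n) n) + 2"
  \<comment> \<open>\<open>\<beta>\<close> records the decisions made so far, and
    \<open>\<gamma>\<close> is an optimal assignment that agrees with them.\<close>
  let ?I = "\<lambda>k s'. k \<le> n \<and> s' vCounter = enc_nat k \<and> (\<exists>\<beta> \<gamma>. s' vClauses = enc_list enc_clause (fixing \<beta> [k..<n] @ cs) \<and>
      s' vOutput = enc_list enc_bool (map \<beta> [k..<n]) \<and> (\<forall>v \<in> {k..<n}. \<gamma> v = \<beta> v) \<and>
      num_violated cs \<gamma> = min_violated cs)"
  have min_le: "min_violated cs \<le> ?m"
    using min_violated_le[of cs undefined] by (rule le_trans) (simp add: num_violated_def)
  have loop: "reaches (While (EVar vCounter) fix_prog) s1 ?F
      (\<lambda>s'. \<exists>\<beta>. s' vOutput = enc_list enc_bool (map \<beta> [0..<n]) \<and> num_violated cs \<beta> = min_violated cs)"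
    if s1: "s1 vCounter = enc_nat n" "s1 vClauses = enc_list enc_clause cs" "s1 vOutput = Leaf"
      "spine (s1 vTarget) = min_violated cs" "s1 vTables = ?e (branches covs ?u)" "s1 vGroups = enc_nat (?u * q)" for s1
  proof (rule reaches_While_count[where k = n and T = "fix_time (?m + n) n" and I = ?I])
    obtain \<gamma> where "num_violated cs \<gamma> = min_violated cs" by (rule min_violated_attained)
    moreover have "s1 vClauses = enc_list enc_clause (fixing \<gamma> [n..<n] @ cs)"
      "s1 vOutput = enc_list enc_bool (map \<gamma> [n..<n])" using s1 by (simp_all add: fixing_def)
    ultimately show "?I n s1" using s1(1) by blast
  next
    fix k s' assume I: "?I (Suc k) s'" and fr: "\<And>v. v \<notin> writes fix_prog \<Longrightarrow> s' v = s1 v"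
    then obtain \<beta> \<gamma> where bg: "s' vClauses = enc_list enc_clause (fixing \<beta> [Suc k..<n] @ cs)"
      "s' vOutput = enc_list enc_bool (map \<beta> [Suc k..<n])" "\<forall>v \<in> {Suc k..<n}. \<gamma> v = \<beta> v"
      "num_violated cs \<gamma> = min_violated cs" by blast
    have k: "k < n" using conjunct1[OF I] by simp
    let ?c = "\<lambda>x. [(k, x), (k, x)]"
    let ?cs = "fixing \<beta> [Suc k..<n] @ cs"
    define x where "x = (min_violated (?c True # ?cs) \<le> min_violated cs)"
    have step: "reaches fix_prog s' (fix_time (?m + n) n) (\<lambda>s'. s' vCounter = enc_nat k \<and>
       s' vClauses = enc_list enc_clause (?c x # ?cs) \<and> s' vOutput = Node (enc_bool x) (enc_list enc_bool (map \<beta> [Suc k..<n])))"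
    proof (rule reaches_fix_prog[where s = s', OF _ bg(1,2) _ _ _ valid_fixing[OF cs k] _ _ x_def])
      show "s' vCounter = enc_nat (Suc k)" using I by blast
    qed (use fr[of vTarget] fr[of "vTables"] fr[of vGroups] s1(4-6) k min_le in \<open>simp_all add: fixing_def\<close>)
    have inv: "?I k s2"
      if s2: "s2 vCounter = enc_nat k" "s2 vClauses = enc_list enc_clause (?c x # ?cs)"
        "s2 vOutput = Node (enc_bool x) (enc_list enc_bool (map \<beta> [Suc k..<n]))" for s2
    proof -
      define \<beta>' where "\<beta>' = \<beta>(k := x)"
      have up: "[k..<n] = k # [Suc k..<n]" using k by (simp add: upt_conv_Cons)
      have eq: "fixing \<beta>' [k..<n] = ?c x # fixing \<beta> [Suc k..<n]" "map \<beta>' [k..<n] = x # map \<beta> [Suc k..<n]"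
        by (auto simp: up \<beta>'_def fixing_def)
      have split: "num_violated (?c True # ?cs) \<delta> =
          num_violated (fixing (\<beta>(k := True)) [k..<n]) \<delta> + num_violated cs \<delta>" for \<delta>
      proof -
        have "fixing (\<beta>(k := True)) [k..<n] = ?c True # fixing \<beta> [Suc k..<n]"
          by (auto simp: up fixing_def)
        then show ?thesis using num_violated_append[of "?c True # fixing \<beta> [Suc k..<n]" cs \<delta>] by simp
      qed
      have "\<exists>\<delta>. (\<forall>v \<in> {k..<n}. \<delta> v = \<beta>' v) \<and> num_violated cs \<delta> = min_violated cs"
      proof (cases x)
        case True
        obtain \<delta> where "num_violated (?c True # ?cs) \<delta> = min_violated (?c True # ?cs)"
          by (rule min_violated_attained)
        \<comment> \<open>The second summand is at least the optimum of \<open>cs\<close>, so the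
          first one vanishes: \<open>\<delta>\<close> respects all decisions and is itself
          optimal.\<close>
        then have le: "num_violated (fixing (\<beta>(k := True)) [k..<n]) \<delta> + num_violated cs \<delta> \<le> min_violated cs"
          using True split[of \<delta>] by (simp add: x_def)
        with min_violated_le[of cs \<delta>]
        have zero: "num_violated (fixing (\<beta>(k := True)) [k..<n]) \<delta> = 0" and "num_violated cs \<delta> = min_violated cs"
          by linarith+
        moreover have "\<forall>v \<in> {k..<n}. \<delta> v = \<beta>' v"
          using zero True unfolding num_violated_fixing_eq_0 by (simp add: \<beta>'_def)
        ultimately show ?thesis by blast
      next
        case False
        \<comment> \<open>If \<open>\<gamma> k\<close> were True, \<open>\<gamma>\<close> would
          violate no fixing clause and show that the optimum does not rise.\<close>
        have "\<gamma> k = False"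
        proof (rule ccontr)
          assume "\<gamma> k \<noteq> False"
          then have "num_violated (fixing (\<beta>(k := True)) [k..<n]) \<gamma> = 0"
            using bg(3) by (auto simp: num_violated_fixing_eq_0)
          then have "min_violated (?c True # ?cs) \<le> min_violated cs"
            using min_violated_le[of "?c True # ?cs" \<gamma>] split[of \<gamma>] bg(4) by simp
          with False show False by (simp add: x_def)
        qed
        then have "\<forall>v \<in> {k..<n}. \<gamma> v = \<beta>' v"
          using False bg(3) by (auto simp: \<beta>'_def less_eq_Suc_le)
        with bg(4) show ?thesis by blast
      qed
      then obtain \<delta> where "\<forall>v \<in> {k..<n}. \<delta> v = \<beta>' v" "num_violated cs \<delta> = min_violated cs" by blast
      moreover have "s2 vClauses = enc_list enc_clause (fixing \<beta>' [k..<n] @ cs)"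
        "s2 vOutput = enc_list enc_bool (map \<beta>' [k..<n])" unfolding eq s2(2,3) by simp_all
      ultimately show ?thesis using s2(1) less_imp_le[OF k] by blast
    qed
    have "reaches fix_prog s' (fix_time (?m + n) n) (?I k)"
      by (rule reaches_mono[OF step order_refl], rule inv) blast+
    moreover have "eval (EVar vCounter) s' \<noteq> Leaf" using conjunct1[OF conjunct2[OF I]] by simp
    ultimately show "eval (EVar vCounter) s' \<noteq> Leaf \<and> reaches fix_prog s' (fix_time (?m + n) n) (?I k)" by blast
  next
    fix s' assume "?I 0 s'"
    then obtain \<beta> \<gamma> where bg: "s' vCounter = enc_nat 0" "s' vOutput = enc_list enc_bool (map \<beta> [0..<n])"
      "\<forall>v \<in> {0..<n}. \<gamma> v = \<beta> v" "num_violated cs \<gamma> = min_violated cs" by blast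
    then have "num_violated cs \<beta> = min_violated cs"
      using num_violated_cong[OF cs(1), of \<beta> \<gamma>] by simp
    with bg show "eval (EVar vCounter) s' = Leaf \<and>
      (\<exists>\<beta>. s' vOutput = enc_list enc_bool (map \<beta> [0..<n]) \<and> num_violated cs \<beta> = min_violated cs)"
      by (metis enc_nat.simps(1) eval.simps(1))
  qed simp
  have final: "reaches (Seq (While (EVar vCounter) fix_prog) (Assign 0 (EVar vOutput))) s1 (?F + 2) ?Q"
    if s1: "s1 vCounter = enc_nat n" "s1 vClauses = enc_list enc_clause cs" "s1 vOutput = Leaf"
      "spine (s1 vTarget) = min_violated cs" "s1 vTables = ?e (branches covs ?u)" "s1 vGroups = enc_nat (?u * q)" for s1
    by (rule reaches_Seq[where T' = 2, OF reaches_mono[OF loop[OF s1] order_refl]])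
      (auto intro!: reaches_Assign)
  have opt: "reaches (Seq opt_prog (Seq (Assign vTarget (EVar vBest)) (Seq (Assign vOutput ELeaf)
      (Seq (Assign vCounter (EVar vNum)) (Seq (While (EVar vCounter) fix_prog) (Assign 0 (EVar vOutput))))))) s1
      (opt_time ?m n ?u + ?F + 8) ?Q"
    if s1: "s1 vNum = enc_nat n" "s1 vClauses = enc_list enc_clause cs" "s1 vTables = ?e (branches covs ?u)"
      "s1 vGroups = enc_nat (?u * q)" for s1
  proof (rule reaches_Seq[where T' = "?F + 8",
        OF reaches_mono[OF reaches_opt_prog[OF s1(3,2,4) cs(1) order_refl num_blocks_ge] order_refl]])
    fix s2 assume s2: "spine (s2 vBest) = min_violated cs" "\<And>v. v \<notin> writes opt_prog \<Longrightarrow> s2 v = s1 v"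
    show "reaches (Seq (Assign vTarget (EVar vBest)) (Seq (Assign vOutput ELeaf)
      (Seq (Assign vCounter (EVar vNum)) (Seq (While (EVar vCounter) fix_prog) (Assign 0 (EVar vOutput)))))) s2 (?F + 8) ?Q"
      by (rule reaches_Assign_Seq[where T = "?F + 6"], rule reaches_Assign_Seq[where T = "?F + 4"],
          rule reaches_Assign_Seq[where T = "?F + 2"], rule final)
        (use s1 s2 in simp_all)
  qed simp
  define s1 where "s1 = s(vNum := enc_nat n, vClauses := enc_list enc_clause cs)"
  have init: "reaches (Seq init_prog (Seq opt_prog (Seq (Assign vTarget (EVar vBest)) (Seq (Assign vOutput ELeaf)
      (Seq (Assign vCounter (EVar vNum)) (Seq (While (EVar vCounter) fix_prog) (Assign 0 (EVar vOutput)))))))) s1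
      (init_time n + opt_time ?m n ?u + ?F + 8) ?Q"
    by (rule reaches_Seq[where T' = "opt_time ?m n ?u + ?F + 8", OF reaches_mono[OF reaches_init_prog order_refl]],
        simp add: s1_def, rule opt) (simp_all add: s1_def)
  show ?thesis unfolding solver_def solver_time_def
    by (rule reaches_Assign_Seq[where T = "init_time n + opt_time ?m n ?u + ?F + 11"],
        rule reaches_Assign_Seq[where T = "init_time n + opt_time ?m n ?u + ?F + 8"])
      (use init s in \<open>simp_all add: s1_def\<close>)
qed

end

section \<open>Running time\<close>

text \<open>Unlike \<open>poly_growth\<close>, the bound holds for every \<open>n\<close>;
  \<open>n + 1\<close> keeps powers monotone in the exponent also at \<open>n = 0\<close>.\<close>

definition poly_bounded :: "(nat \<Rightarrow> nat) \<Rightarrow> bool" where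
  "poly_bounded f \<longleftrightarrow> (\<exists>A a. \<forall>n. f n \<le> A * (n + 1) ^ a)"

lemma poly_bounded_const [intro]: "poly_bounded (\<lambda>_. c)"
  unfolding poly_bounded_def by (rule exI[of _ c], rule exI[of _ 0]) simp

lemma poly_bounded_ident [intro]: "poly_bounded (\<lambda>n. n)"
  unfolding poly_bounded_def by (rule exI[of _ 1], rule exI[of _ 1]) simp

lemma poly_bounded_add [intro]:
  assumes "poly_bounded f" "poly_bounded g"
  shows "poly_bounded (\<lambda>n. f n + g n)"
proof -
  from assms obtain A a B b where f: "\<And>n. f n \<le> A * (n + 1) ^ a" and g: "\<And>n. g n \<le> B * (n + 1) ^ b"
    unfolding poly_bounded_def by blast
  have "f n + g n \<le> (A + B) * (n + 1) ^ (a + b)" for n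
  proof -
    have "f n \<le> A * (n + 1) ^ (a + b)"
      by (rule le_trans[OF f]) (auto intro!: mult_le_mono2 power_increasing)
    moreover have "g n \<le> B * (n + 1) ^ (a + b)"
      by (rule le_trans[OF g]) (auto intro!: mult_le_mono2 power_increasing)
    ultimately show ?thesis unfolding add_mult_distrib by (rule add_mono)
  qed
  then show ?thesis unfolding poly_bounded_def by blast
qed

lemma poly_bounded_mult [intro]:
  assumes "poly_bounded f" "poly_bounded g"
  shows "poly_bounded (\<lambda>n. f n * g n)"
proof -
  from assms obtain A a B b where f: "\<And>n. f n \<le> A * (n + 1) ^ a" and g: "\<And>n. g n \<le> B * (n + 1) ^ b"
    unfolding poly_bounded_def by blast
  have "f n * g n \<le> (A * B) * (n + 1) ^ (a + b)" for n
    using mult_le_mono[OF f g, of n n] by (simp add: power_add mult_ac)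
  then show ?thesis unfolding poly_bounded_def by blast
qed

lemma poly_bounded_power [intro]: "poly_bounded f \<Longrightarrow> poly_bounded (\<lambda>n. f n ^ k)"
  by (induction k) auto

lemma poly_growth_upper_bound:
  assumes "poly_growth g"
  obtains C c :: nat where "\<And>n. g n \<le> real (C * (n + 1) ^ c)"
proof -
  from assms obtain c where "g \<in> O(\<lambda>n. real n ^ c)" by (auto simp: poly_growth_def)
  then obtain K where "K > 0" "eventually (\<lambda>n. norm (g n) \<le> K * norm (real n ^ c)) at_top"
    by (rule landau_o.bigE)
  then obtain N where N: "\<And>n. n \<ge> N \<Longrightarrow> \<bar>g n\<bar> \<le> K * real n ^ c"
    by (auto simp: eventually_at_top_linorder)
  \<comment> \<open>The sum absorbs the finitely many arguments at which the asymptotic bound may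
    fail.\<close>
  define L where "L = K + (\<Sum>n<N. \<bar>g n\<bar>)"
  have "g n \<le> real (nat \<lceil>L\<rceil> * (n + 1) ^ c)" for n
  proof -
    have "g n \<le> L * real ((n + 1) ^ c)"
    proof (cases "n < N")
      case True
      have "g n \<le> (\<Sum>n<N. \<bar>g n\<bar>)"
        using member_le_sum[of n "{..<N}" "\<lambda>n. \<bar>g n\<bar>"] True by simp
      also have "\<dots> \<le> L * 1" using \<open>K > 0\<close> by (simp add: L_def)
      also have "\<dots> \<le> L * real ((n + 1) ^ c)"
        using \<open>K > 0\<close> by (intro mult_left_mono) (auto simp: L_def sum_nonneg simp del: of_nat_power)
      finally show ?thesis .
    next
      case False
      then have "g n \<le> K * real n ^ c" using N[of n] by simp
      also have "\<dots> \<le> L * real ((n + 1) ^ c)"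
        using \<open>K > 0\<close> by (auto intro!: mult_mono power_mono simp: L_def sum_nonneg)
      finally show ?thesis .
    qed
    also have "\<dots> \<le> real (nat \<lceil>L\<rceil>) * real ((n + 1) ^ c)"
      by (intro mult_right_mono real_nat_ceiling_ge) auto
    finally show ?thesis by simp
  qed
  then show ?thesis by (rule that)
qed

lemma poly_growth_shifted_power: "poly_growth (\<lambda>n. A * real (n + 1) ^ a)"
proof -
  have "(\<lambda>n. A * real (n + 1) ^ a) \<in> O(\<lambda>n. real n ^ a)"
  \<comment> \<open>The constant comes from \<open>n + 1 \<le> 2 * n\<close> for
    \<open>n \<ge> 1\<close>.\<close>
  proof (rule bigoI[of _ "\<bar>A\<bar> * 2 ^ a"])
    have "norm (A * real (n + 1) ^ a) \<le> \<bar>A\<bar> * 2 ^ a * norm (real n ^ a)" if "n \<ge> 1" for n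
    proof -
      have "real (n + 1) ^ a \<le> (2 * real n) ^ a" using that by (intro power_mono) auto
      then show ?thesis by (auto simp: abs_mult power_mult_distrib mult.assoc intro!: mult_left_mono)
    qed
    then show "\<forall>\<^sub>F n in sequentially. norm (A * real (n + 1) ^ a) \<le> \<bar>A\<bar> * 2 ^ a * norm (real n ^ a)"
      by (auto simp: eventually_at_top_linorder)
  qed
  then show ?thesis unfolding poly_growth_def by blast
qed

section \<open>Looking up relations by their keys\<close>

lemma enc_bool_inject [simp]: "enc_bool x = enc_bool y \<longleftrightarrow> x = y"
  by (cases x; cases y) auto

lemma enc_list_inject: "(\<And>x y. f x = f y \<Longrightarrow> x = y) \<Longrightarrow> enc_list f xs = enc_list f ys \<Longrightarrow> xs = ys"
proof (induction xs arbitrary: ys)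
  case Nil
  then show ?case by (cases ys) auto
next
  case (Cons x xs)
  then show ?case by (cases ys) auto
qed

lemma enc_key_inject: "enc_key xs = enc_key ys \<Longrightarrow> xs = ys"
proof (erule enc_list_inject[rotated])
  fix x y :: "bool list \<times> bool"
  assume "enc_pair (enc_list enc_bool) enc_bool x = enc_pair (enc_list enc_bool) enc_bool y"
  then have "enc_list enc_bool (fst x) = enc_list enc_bool (fst y)" "snd x = snd y"
    by (simp_all add: enc_pair_eq)
  moreover from this(1) have "fst x = fst y" by (rule enc_list_inject[rotated]) simp
  ultimately show "x = y" by (simp add: prod_eq_iff)
qed

text \<open>Bounding both the number of entries and the length of their tables leaves finitely many
  keys. As encodings are injective, \<open>f\<close> can be carried over to trees.\<close>

lemma exists_lookup_prog:
  fixes f :: "(bool list \<times> bool) list \<Rightarrow> tree"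
  shows "\<exists>lk T. writes lk = {w} \<and> (\<forall>s ks. s v = enc_key ks \<longrightarrow> length ks \<le> m \<longrightarrow>
    (\<forall>k \<in> set ks. length (fst k) = d) \<longrightarrow> reaches lk s T (\<lambda>s'. s' w = f ks))"
proof -
  let ?K = "{ks :: (bool list \<times> bool) list. set ks \<subseteq> {xs. set xs \<subseteq> UNIV \<and> length xs = d} \<times> UNIV \<and> length ks \<le> m}"
  have "finite (enc_key ` ?K)"
    by (intro finite_imageI finite_lists_length_le finite_cartesian_product finite_lists_length_eq) auto
  from finite_function_prog[OF this, of w "EVar v" "\<lambda>x. f (the_inv enc_key x)"]
  obtain lk T where lk: "writes lk = {w}"
    "\<And>s. s v \<in> enc_key ` ?K \<Longrightarrow> reaches lk s T (\<lambda>s'. s' w = f (the_inv enc_key (s v)))" by auto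
  have "reaches lk s T (\<lambda>s'. s' w = f ks)"
    if "s v = enc_key ks" "length ks \<le> m" "\<forall>k \<in> set ks. length (fst k) = d" for s ks
  proof -
    have "the_inv enc_key (s v) = ks"
      unfolding that(1) by (rule the_inv_f_f) (auto intro: injI enc_key_inject)
    moreover have "s v \<in> enc_key ` ?K" using that by force
    ultimately show ?thesis using lk(2)[of s] by simp
  qed
  with lk(1) show ?thesis by blast
qed

section \<open>Total time of the solver\<close>

context reduction
begin

text \<open>There are four possible lengths, each with at most \<open>(2 * n + 1) ^ 3\<close> lists
  over \<open>2 * n\<close> literals. Lists are counted because \<open>valid\<close> distinguishes
  orders and repetitions.\<close>

definition max_clauses :: "nat \<Rightarrow> nat" where
  "max_clauses n = 4 * (2 * n + 1) ^ 3"

lemma valid_length_le: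
  assumes "valid n cs"
  shows "length cs \<le> max_clauses n"
proof -
  let ?A = "{..<n} \<times> (UNIV :: bool set)"
  have "length cs = card (set cs)" using assms by (simp add: valid_def distinct_card)
  also have "\<dots> \<le> card {c. set c \<subseteq> ?A \<and> length c \<le> 3}"
    using assms by (intro card_mono finite_lists_length_le) (fastforce simp: valid_def)+
  also have "\<dots> = (\<Sum>i\<le>3. (2 * n) ^ i)"
    by (subst card_lists_length_le) (auto simp: card_cartesian_product mult.commute)
  also have "\<dots> \<le> (\<Sum>i\<le>(3::nat). (2 * n + 1) ^ 3)"
  proof (rule sum_mono)
    fix i :: nat assume "i \<in> {..3}"
    have "(2 * n) ^ i \<le> (2 * n + 1) ^ i" by (rule power_mono) auto
    also have "\<dots> \<le> (2 * n + 1) ^ 3" using \<open>i \<in> {..3}\<close> by (intro power_increasing) auto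
    finally show "(2 * n) ^ i \<le> (2 * n + 1) ^ 3" .
  qed
  finally show ?thesis by (simp add: max_clauses_def)
qed

text \<open>\<open>M\<close> allows for the \<open>n\<close> clauses added by the self-reduction.
  \<open>B\<close> bounds the work on one branch outside the Max-CSP subroutine.\<close>

definition overhead :: "nat \<Rightarrow> nat" where
  "overhead n = (let M = max_clauses n + n; B = M * (24 * n + 110 + Tl) + 2 * V + 8 * M + 45 in
     (n * (2 + (cost new_expr + 6) + block_const) + 10) + B + n * (2 + B + 8 * M + 60) + 20)"

lemma poly_bounded_overhead: "poly_bounded overhead"
  unfolding overhead_def[abs_def] Let_def max_clauses_def by (intro poly_bounded_add poly_bounded_mult
      poly_bounded_const poly_bounded_power poly_bounded_ident)

lemma num_blocks_bounds: "num_blocks n \<le> n" "num_blocks n * (b * q) \<le> n + b * q"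
proof -
  show "num_blocks n \<le> n"
  proof (cases "num_blocks n")
    case (Suc u)
    then have "u * (b * q) < n" by (intro num_blocks_minimal) simp
    moreover have "u * 1 \<le> u * (b * q)" using bq_pos by (intro mult_le_mono2) simp
    ultimately show ?thesis using Suc by linarith
  qed simp
  have "num_blocks n * (b * q) \<le> n + b * q - 1" unfolding num_blocks_def by simp
  then show "num_blocks n * (b * q) \<le> n + b * q" by linarith
qed

text \<open>Everything exponential is a multiple of the number of branches times
  \<open>Tp + 1\<close>. The added 1 makes this factor positive, so polynomial terms can be charged
  to it as well.\<close>

lemma solver_time_le:
  assumes "m \<le> max_clauses n"
  shows "solver_time m n \<le> length covs ^ num_blocks n * (Tp (num_blocks n * q) + 1) * overhead n"
proof -
  define u where "u = num_blocks n"
  define X where "X = length covs ^ u * (Tp (u * q) + 1)"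
  define M where "M = max_clauses n + n"
  define B where "B = M * (24 * n + 110 + Tl) + 2 * V + 8 * M + 45"
  have K1: "length covs ^ u \<ge> 1" using covs_nonempty by simp
  have X1: "X \<ge> 1" using K1 by (simp add: X_def)
  have KX: "length covs ^ u \<le> X" by (simp add: X_def)
  have scale: "c \<le> X * c" for c using X1 mult_le_mono1[of 1 X c] by simp
  have opt: "opt_time L n u \<le> X * B" if "L \<le> M" for L
  proof -
    have "L * (24 * n + 110 + Tl) \<le> M * (24 * n + 110 + Tl)" using that by (rule mult_le_mono1)
    \<comment> \<open>The final 6 is the additive constant of \<open>opt_time\<close>, charged to
      each branch since there is at least one.\<close>
    then have "2 + branch_time L n (u * q) + 6 \<le> Tp (u * q) + B"
      using that unfolding branch_time_def build_time_def B_def by linarith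
    also have "\<dots> \<le> (Tp (u * q) + 1) * B" by (simp add: B_def)
    finally have "length covs ^ u * (2 + branch_time L n (u * q) + 6) \<le> length covs ^ u * ((Tp (u * q) + 1) * B)"
      by (rule mult_le_mono2)
    also have "\<dots> = X * B" by (simp only: X_def mult.assoc)
    finally have "length covs ^ u * (2 + branch_time L n (u * q)) + length covs ^ u * 6 \<le> X * B"
      by (simp add: algebra_simps)
    then show ?thesis using K1 unfolding opt_time_def by linarith
  qed
  have mn: "m + n \<le> M" using assms by (simp add: M_def)
  have "fix_time (m + n) n \<le> X * B + X * (8 * M + 60)"
    unfolding fix_time_def u_def[symmetric] add.assoc
    using mn by (intro add_mono opt le_trans[OF _ scale]) auto
  then have fixing: "n * (2 + fix_time (m + n) n) \<le> X * (n * (2 + B + 8 * M + 60))"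
  proof -
    assume "fix_time (m + n) n \<le> X * B + X * (8 * M + 60)"
    then have "2 + fix_time (m + n) n \<le> X * (2 + B + 8 * M + 60)"
      using scale[of 2] by (simp add: algebra_simps)
    then have "n * (2 + fix_time (m + n) n) \<le> n * (X * (2 + B + 8 * M + 60))" by (rule mult_le_mono2)
    then show ?thesis by (simp only: mult.left_commute)
  qed
  have "init_time n \<le> n * (2 + (length covs ^ u * (cost new_expr + 6) + block_const)) + 10"
    unfolding init_time_def u_def[symmetric]
    by (intro add_mono mult_le_mono1 order_refl) (simp add: u_def num_blocks_bounds(1))
  also have "\<dots> \<le> n * (X * (2 + (cost new_expr + 6) + block_const)) + X * 10"
  proof (intro add_mono mult_le_mono2 scale)
    have "length covs ^ u * (cost new_expr + 6) \<le> X * (cost new_expr + 6)" using KX by (rule mult_le_mono1)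
    then have "2 + (length covs ^ u * (cost new_expr + 6) + block_const) \<le>
        X * 2 + (X * (cost new_expr + 6) + X * block_const)" by (intro add_mono scale)
    then show "2 + (length covs ^ u * (cost new_expr + 6) + block_const) \<le> X * (2 + (cost new_expr + 6) + block_const)"
      by (simp only: distrib_left add.assoc)
  qed
  also have "\<dots> = X * (n * (2 + (cost new_expr + 6) + block_const) + 10)" by (simp add: algebra_simps)
  finally have init: "init_time n \<le> X * (n * (2 + (cost new_expr + 6) + block_const) + 10)" .
  have "solver_time m n \<le> X * (n * (2 + (cost new_expr + 6) + block_const) + 10) + X * B
      + X * (n * (2 + B + 8 * M + 60)) + X * 20"
    unfolding solver_time_def u_def[symmetric]
    using assms by (intro add_mono init opt fixing scale) (simp add: M_def)
  also have "\<dots> = X * overhead n"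
    unfolding overhead_def Let_def M_def[symmetric] B_def[symmetric] by (simp add: distrib_left)
  finally show ?thesis unfolding X_def u_def .
qed

lemma runs_solver:
  assumes "cnf3 n \<phi>" "cnf_input n \<phi> x"
  shows "\<exists>t \<beta>. runs solver x t (enc_list enc_bool (map \<beta> [0..<n])) \<and> optimal_assignment \<phi> \<beta> \<and>
    t \<le> length covs ^ num_blocks n * (Tp (num_blocks n * q) + 1) * overhead n"
proof -
  from assms(2) obtain cs where cs: "distinct (map set cs)" "\<And>c. c \<in> set cs \<Longrightarrow> distinct c" "\<phi> = set ` set cs"
    "x = Node (enc_nat n) (enc_list enc_clause cs)" unfolding cnf_input_def by blast
  have val: "valid n cs"
    unfolding valid_def
  proof (intro conjI ballI)
    show "distinct cs" using cs(1) by (simp add: distinct_map)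
    fix c assume c: "c \<in> set cs"
    then have "set c \<subseteq> {..<n} \<times> UNIV" "card (set c) \<le> 3" using assms(1) cs(3) by (auto simp: cnf3_def)
    then show "length c \<le> 3" using distinct_card[OF cs(2)[OF c]] by simp
    show "fst l < n" if "l \<in> set c" for l using \<open>set c \<subseteq> {..<n} \<times> UNIV\<close> that by auto
  qed
  have viol: "card (violated \<phi> \<beta>) = num_violated cs \<beta>" for \<beta>
  proof -
    let ?L = "filter (\<lambda>c. \<forall>l \<in> set c. \<beta> (fst l) \<noteq> snd l) cs"
    have "violated \<phi> \<beta> = {c \<in> \<phi>. \<forall>l \<in> c. \<beta> (fst l) \<noteq> snd l}"
      unfolding violated_def case_prod_beta by blast
    also have "\<dots> = set ` set ?L" unfolding cs(3) by auto
    finally have "card (violated \<phi> \<beta>) = card (set ` set ?L)" by simp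
    also have "\<dots> = card (set ?L)"
    proof (rule card_image)
      have "inj_on set (set cs)" using cs(1) by (simp add: distinct_map)
      then show "inj_on set (set ?L)" by (rule inj_on_subset) auto
    qed
    also have "\<dots> = num_violated cs \<beta>"
      unfolding num_violated_def using val by (intro distinct_card) (simp add: valid_def)
    finally show ?thesis .
  qed
  have "reaches solver ((\<lambda>_. Leaf)(0 := x)) (solver_time (length cs) n) (\<lambda>s'. \<exists>\<beta>.
      s' 0 = enc_list enc_bool (map \<beta> [0..<n]) \<and> num_violated cs \<beta> = min_violated cs)"
    using cs(4) by (intro reaches_solver[OF val cs(2)]) simp_all
  then obtain t s' \<beta> where t: "exec solver ((\<lambda>_. Leaf)(0 := x)) t s'" "t \<le> solver_time (length cs) n"
    "s' 0 = enc_list enc_bool (map \<beta> [0..<n])" "num_violated cs \<beta> = min_violated cs"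
    unfolding reaches_def by blast
  have "optimal_assignment \<phi> \<beta>"
    unfolding optimal_assignment_def viol t(4) by (simp add: min_violated_le)
  moreover have "runs solver x t (enc_list enc_bool (map \<beta> [0..<n]))" using t(1,3) by (auto simp: runs_def)
  ultimately show ?thesis using le_trans[OF t(2) solver_time_le[OF valid_length_le[OF val]]] by blast
qed

end

section \<open>From a fast Max-CSP algorithm to a fast Max 3-Sat algorithm\<close>

lemma exists_num_bits:
  fixes d :: nat
  assumes "d \<ge> 2"
  obtains b where "d \<le> 2 ^ b" "2 ^ b < 2 * d"
proof -
  define b where "b = (LEAST b. d \<le> 2 ^ b)"
  have "d \<le> 2 ^ b" unfolding b_def by (rule LeastI[of _ d]) (simp add: less_imp_le)
  moreover from this obtain k where k: "b = Suc k" using assms by (cases b) auto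
  have "\<not> d \<le> 2 ^ k" using not_less_Least[of k "\<lambda>b. d \<le> 2 ^ b"] k b_def by simp
  then have "2 ^ b < 2 * d" by (simp add: k)
  ultimately show ?thesis using that by blast
qed

text \<open>For a block of \<open>b * q\<close> Boolean variables, the choice of a covering vector
  and the exponential part of the Max-CSP time together contribute a factor below
  \<open>2 ^ (b * q)\<close>.\<close>

lemma max_3sat_from_max_csp:
  fixes d r :: nat and \<epsilon> :: real
  assumes d: "d \<ge> 2" and r: "r \<ge> 3" and eps: "0 < \<epsilon>" "\<epsilon> < d"
    and g: "poly_growth g" and p: "solves_max_csp p d r (\<lambda>n. (d - \<epsilon>) ^ n * g n)"
  shows "\<exists>\<epsilon>::real. 0 < \<epsilon> \<and> \<epsilon> < 2 \<and>
         (\<exists>p g. poly_growth g \<and> solves_max_3sat p (\<lambda>n. (2 - \<epsilon>) ^ n * g n))"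
proof -
  \<comment> \<open>The maximum with 1 lets powers of the base absorb additive constants;
    \<open>d \<ge> 2\<close> keeps it below \<open>d\<close>.\<close>
  define \<delta> where "\<delta> = max (d - \<epsilon>) 1"
  have \<delta>: "\<delta> \<ge> 1" "\<delta> < d" using d eps by (auto simp: \<delta>_def)
  obtain b where b: "d \<le> 2 ^ b" "2 ^ b < 2 * d" using exists_num_bits[OF d] by blast
  obtain q covs where q: "q > 0" "\<forall>c \<in> set covs. length c = q"
    "\<forall>xs. length xs = q \<and> set xs \<subseteq> {..<2 ^ b} \<longrightarrow> (\<exists>c \<in> set covs. list_all2 (in_row (2 ^ b) d) xs c)"
    and cheap: "length covs * \<delta> ^ q < 2 ^ (b * q)"
    using exists_cheap_cover[of d "2 ^ b" "d - \<delta>"] d b \<delta> by (auto simp: power_mult)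
  obtain C c where C: "\<And>n. g n \<le> real (C * (n + 1) ^ c)" using poly_growth_upper_bound[OF g] by blast
  \<comment> \<open>Running times are integers, so the floor loses nothing; where the product is
    negative, \<open>nat\<close> makes the bound 0.\<close>
  define Tp where "Tp = (\<lambda>n. nat \<lfloor>(d - \<epsilon>) ^ n * g n\<rfloor>)"
  have Tp: "real (Tp n + 1) \<le> \<delta> ^ n * real (C * (n + 1) ^ c + 1)" for n
  proof -
    have "(d - \<epsilon>) ^ n * g n \<le> (d - \<epsilon>) ^ n * real (C * (n + 1) ^ c)"
      using C eps by (intro mult_left_mono) auto
    also have "\<dots> \<le> \<delta> ^ n * real (C * (n + 1) ^ c)"
      using eps by (intro mult_right_mono power_mono) (auto simp: \<delta>_def)
    finally have le: "(d - \<epsilon>) ^ n * g n \<le> \<delta> ^ n * real (C * (n + 1) ^ c)" .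
    have "real (Tp n) \<le> \<delta> ^ n * real (C * (n + 1) ^ c)"
    proof (cases "0 \<le> (d - \<epsilon>) ^ n * g n")
      case True
      then show ?thesis unfolding Tp_def using le by (rule order_trans[OF of_nat_floor])
    next
      case False
      then show ?thesis unfolding Tp_def using \<delta>(1) by simp
    qed
    moreover have "1 \<le> \<delta> ^ n" using \<delta>(1) by simp
    ultimately show ?thesis by (simp add: distrib_left)
  qed
  interpret branching d b by standard (use d b in auto)
  define V where "V = Max (insert 0 (prog_vars p))"
  obtain lk Tl where lk: "writes lk = {V + 16}"
    "\<And>s ks. s (V + 13) = enc_key ks \<Longrightarrow> length ks \<le> 3 \<Longrightarrow> (\<And>k. k \<in> set ks \<Longrightarrow> length (fst k) = d) \<Longrightarrow>
      reaches lk s Tl (\<lambda>s'. s' (V + 16) = enc_list (enc_list enc_nat) (rel ks))"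
    using exists_lookup_prog[of "V + 16" "V + 13" 3 d "\<lambda>ks. enc_list (enc_list enc_nat) (rel ks)"]
    by (elim exE conjE) (rule that, assumption, blast)
  interpret reduction d b covs q p V Tp lk Tl
  proof
    show "prog_vars p \<subseteq> {..V}" by (auto simp: V_def)
    fix n C x assume "csp_instance d 3 n C" and inp: "csp_input n C x"
    \<comment> \<open>Arity three suffices for clauses, and \<open>r\<close> only bounds the arity
      from above.\<close>
    then have "csp_instance d r n C" using r by (force simp: csp_instance_def)
    with p inp obtain t where "runs p x t (enc_nat (max_csp d n C))" "real t \<le> (d - \<epsilon>) ^ n * g n"
      unfolding solves_max_csp_def by blast
    then show "\<exists>t \<le> Tp n. runs p x t (enc_nat (max_csp d n C))"
      unfolding Tp_def by (meson le_nat_floor)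
  qed (use q lk in auto)
  \<comment> \<open>\<open>Y\<close> is the price of a block and \<open>\<rho>\<close> the price per
    Boolean variable. The maximum with 1 makes powers of \<open>\<rho>\<close> monotone in the
    exponent.\<close>
  define Y where "Y = max (length covs * \<delta> ^ q) 1"
  define \<rho> where "\<rho> = root (b * q) Y"
  have Y: "1 \<le> Y" "Y < 2 ^ (b * q)" using cheap bq_pos by (auto simp: Y_def)
  have \<rho>: "1 \<le> \<rho>" "\<rho> ^ (b * q) = Y"
    using Y bq_pos by (auto simp: \<rho>_def real_root_ge_1_iff real_root_pow_pos2)
  have "\<rho> < 2"
  proof (rule ccontr)
    assume "\<not> \<rho> < 2"
    then have "2 ^ (b * q) \<le> \<rho> ^ (b * q)" by (intro power_mono) auto
    with \<rho>(2) Y(2) show False by simp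
  qed
  define G where "G = (\<lambda>n. (C * (n + b * q + 1) ^ c + 1) * overhead n)"
  have "poly_bounded G" unfolding G_def
    by (intro poly_bounded_add poly_bounded_mult poly_bounded_const poly_bounded_power
        poly_bounded_ident poly_bounded_overhead)
  then obtain A a where G: "\<And>n. G n \<le> A * (n + 1) ^ a" unfolding poly_bounded_def by blast
  have bound: "real (length covs ^ num_blocks n * (Tp (num_blocks n * q) + 1) * overhead n)
      \<le> (2 - (2 - \<rho>)) ^ n * (Y * A * real (n + 1) ^ a)" for n
  proof -
    define u where "u = num_blocks n"
    have "b \<ge> 1" using b_pos by simp
    then have "u * q \<le> u * (b * q)" by simp
    then have uq: "u * q \<le> n + b * q" using num_blocks_bounds(2)[of n] unfolding u_def by (rule le_trans)
    have "real (length covs ^ u * (Tp (u * q) + 1)) \<le>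
        length covs ^ u * (\<delta> ^ (u * q) * real (C * (u * q + 1) ^ c + 1))"
      unfolding of_nat_mult by (rule mult_left_mono[OF Tp[of "u * q", unfolded of_nat_mult]]) simp
    also have "\<dots> = (length covs * \<delta> ^ q) ^ u * real (C * (u * q + 1) ^ c + 1)"
      by (simp add: power_mult_distrib power_mult[symmetric] mult.commute)
    also have "\<dots> \<le> Y ^ u * real (C * (n + b * q + 1) ^ c + 1)"
    proof (intro mult_mono power_mono)
      have "(u * q + 1) ^ c \<le> (n + b * q + 1) ^ c" using uq by (intro power_mono) auto
      then show "real (C * (u * q + 1) ^ c + 1) \<le> real (C * (n + b * q + 1) ^ c + 1)"
        by (simp only: of_nat_le_iff add_le_mono1 mult_le_mono2)
    qed (use Y \<delta> in \<open>auto simp: Y_def\<close>)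
    also have "Y ^ u = \<rho> ^ (u * (b * q))" by (simp add: \<rho>(2)[symmetric] power_mult[symmetric] mult_ac)
    also have "\<rho> ^ (u * (b * q)) \<le> \<rho> ^ (n + b * q)"
      using \<rho>(1) num_blocks_bounds(2)[of n] by (intro power_increasing) (auto simp: u_def)
    \<comment> \<open>The additional factor \<open>Y\<close> pays for a last block that is only
      partly filled.\<close>
    also have "\<rho> ^ (n + b * q) = \<rho> ^ n * Y" by (simp add: power_add \<rho>(2))
    finally have "real (length covs ^ u * (Tp (u * q) + 1)) \<le> \<rho> ^ n * Y * real (C * (n + b * q + 1) ^ c + 1)"
      by (simp add: mult_right_mono)
    then have "real (length covs ^ u * (Tp (u * q) + 1)) * overhead n
        \<le> \<rho> ^ n * Y * real (C * (n + b * q + 1) ^ c + 1) * overhead n"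
      by (rule mult_right_mono) simp
    also have "\<dots> = \<rho> ^ n * Y * real (G n)" unfolding G_def of_nat_mult by (simp only: mult.assoc)
    also have "\<dots> \<le> \<rho> ^ n * Y * real (A * (n + 1) ^ a)"
      using \<rho>(1) Y(1) G[of n] by (intro mult_left_mono) (simp_all only: of_nat_le_iff, simp)
    finally show ?thesis by (simp add: u_def mult_ac)
  qed
  have "solves_max_3sat solver (\<lambda>n. (2 - (2 - \<rho>)) ^ n * (Y * A * real (n + 1) ^ a))"
    unfolding solves_max_3sat_def
  proof (intro allI impI)
    fix n \<phi> x assume "cnf3 n \<phi>" "cnf_input n \<phi> x"
    from runs_solver[OF this] obtain t \<beta> where
      "runs solver x t (enc_list enc_bool (map \<beta> [0..<n]))" "optimal_assignment \<phi> \<beta>"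
      "t \<le> length covs ^ num_blocks n * (Tp (num_blocks n * q) + 1) * overhead n" by blast
    moreover from this(3) have "real t \<le> (2 - (2 - \<rho>)) ^ n * (Y * A * real (n + 1) ^ a)"
      using bound[of n] of_nat_mono[of t] by (meson order_trans)
    ultimately show "\<exists>t \<beta>. runs solver x t (enc_list enc_bool (map \<beta> [0..<n])) \<and> optimal_assignment \<phi> \<beta> \<and>
        real t \<le> (2 - (2 - \<rho>)) ^ n * (Y * A * real (n + 1) ^ a)" by blast
  qed
  moreover have "0 < 2 - \<rho>" "2 - \<rho> < 2" using \<rho>(1) \<open>\<rho> < 2\<close> by auto
  ultimately show ?thesis using poly_growth_shifted_power[of "Y * A" a]
    by (intro exI[of _ "2 - \<rho>"] conjI exI[of _ solver] exI[of _ "\<lambda>n. Y * A * real (n + 1) ^ a"])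
qed

theorem theorem2p2:
  fixes d r :: nat
  assumes "d \<ge> 2" and "r \<ge> 3" and "M3SH"
  shows "\<not> (\<exists>p. \<exists>\<epsilon>::real. 0 < \<epsilon> \<and> \<epsilon> < real d \<and>
              (\<exists>g. poly_growth g \<and> solves_max_csp p d r (\<lambda>n. (real d - \<epsilon>) ^ n * g n)))"
proof (intro notI, elim exE conjE)
  fix p g and \<epsilon> :: real
  assume "0 < \<epsilon>" "\<epsilon> < real d" "poly_growth g" "solves_max_csp p d r (\<lambda>n. (real d - \<epsilon>) ^ n * g n)"
  from max_3sat_from_max_csp[OF assms(1,2) this] assms(3) show False unfolding M3SH_def by (rule notE[rotated])
qed

end
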